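(* Let $G$ be a finite group and let $\gamma=\{\gamma_j:\{1,2,\dots,k\}\to\mathbb{C}\}_{j=0,1,\dots,J}$ be an admissible kernel, that is, $$\sum_{j=1}^J|\gamma_j(r)|^2=1-|\gamma_0(r)|^2\ \ (r=1,\dots,k)\qquad\text{and}\qquad \beta_\gamma:=\min_{1\le r\le k}|\gamma_0(r)|^2>0.$$ Then the associated $G$-scattering transform satisfies, for each $f\in L^2(G)$, $$\|S[P_J]f\|_{2,J}=\|f\|.$$
   Context: $G$ is a finite group (not necessarily abelian). $L^2(G)$ is the space of all functions $f:G\to\mathbb{C}$ with inner product $\langle f,g\rangle=\frac{1}{|G|}\sum_{x\in G}f(x)\overline{g(x)}$ and induced norm $\|f\|$. Convolution is $f*g(x)=\frac{1}{|G|}\sum_{y\in G}f(y)g(y^{-1}x)$. $\pi^1,\dots,\pi^k$ is a complete system of pairwise inequivalent irreducible unitary representations of $G$, $d_r$ is the degree of $\pi^r$ and $\chi^r(x)=\mathrm{Tr}(\pi^r(x))$. Fix an integer $J\ge1$. A kernel is a family of functions $\gamma=\{\gamma_j:\{1,\dots,k\}\to\mathbb{C}\}_{0\le j\le J}$; its $G$-wavelets are $\psi_j(x)=\sum_{r=1}^k d_r\gamma_j(r)\chi^r(x)$, $0\le j\le J$, and we write $\phi=\psi_0$. For $m\ge1$, $\Lambda_J^m=\{1,\dots,J\}^m$ is the set of paths of length $m$; $\Lambda_J^0$ consists only of the empty path $\emptyset$; $P_J=\bigcup_{m\ge0}\Lambda_J^m$. For $f\in L^2(G)$, $U[\emptyset]f=f$,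 $U[j]f=|\psi_j*f|$ (pointwise modulus) for $1\le j\le J$, and $U[p]f=U[j_m]\cdots U[j_1]f$ for $p=(j_1,\dots,j_m)\in\Lambda_J^m$. For $p\in P_J$, $S[p]f=\phi*U[p]f$. The $G$-scattering transform is $S[P_J]f=\{S[p]f\}_{p\in P_J}$, and for a family $F=\{F_p\}_{p\in P_J}$ in $L^2(G)$, $\|F\|_{2,J}=\left(\sum_{p\in P_J}\|F_p\|^2\right)^{1/2}$. *)

theory Defs
  imports
    "HOL-Algebra.Group"
    "HOL-Analysis.Infinite_Sum"
    "Jordan_Normal_Form.VS_Connect"
    "Jordan_Normal_Form.Schur_Decomposition"
begin

section \<open>Representations of a group by unitary matrices\<close>

definition unitary_group :: "nat \<Rightarrow> complex mat monoid" where
  "unitary_group n =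
     \<lparr>carrier = {A \<in> carrier_mat n n. inverts_mat A (mat_adjoint A) \<and> inverts_mat (mat_adjoint A) A},
      monoid.mult = (*), one = 1\<^sub>m n\<rparr>"

definition unitary_rep :: "('a, 'b) monoid_scheme \<Rightarrow> nat \<Rightarrow> ('a \<Rightarrow> complex mat) \<Rightarrow> bool" where
  "unitary_rep G n \<rho> \<longleftrightarrow> \<rho> \<in> hom G (unitary_group n)"

text \<open>The constant \<open>VectorSpace.subspace\<close> (linear subspaces in the sense of \<^locale>\<open>vectorspace\<close>) has
  to be qualified, since the distribution has a type-class based constant of the same name.\<close>

definition invariant_subspace ::
    "('a, 'b) monoid_scheme \<Rightarrow> nat \<Rightarrow> ('a \<Rightarrow> complex mat) \<Rightarrow> complex vec set \<Rightarrow> bool" where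
  "invariant_subspace G n \<rho> W \<longleftrightarrow>
     VectorSpace.subspace class_ring W (module_vec TYPE(complex) n) \<and>
     (\<forall>x\<in>carrier G. \<forall>v\<in>W. \<rho> x *\<^sub>v v \<in> W)"

definition irreducible_unitary_rep ::
    "('a, 'b) monoid_scheme \<Rightarrow> nat \<Rightarrow> ('a \<Rightarrow> complex mat) \<Rightarrow> bool" where
  "irreducible_unitary_rep G n \<rho> \<longleftrightarrow>
     unitary_rep G n \<rho> \<and> n > 0 \<and>
     (\<forall>W. invariant_subspace G n \<rho> W \<longrightarrow> W = {0\<^sub>v n} \<or> W = carrier_vec n)"

text \<open>Equivalence by an invertible intertwiner; \<^const>\<open>invertible_mat\<close> includes squareness,
  so equivalent representations have equal degrees.\<close>

definition equivalent_reps ::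
    "('a, 'b) monoid_scheme \<Rightarrow> nat \<Rightarrow> ('a \<Rightarrow> complex mat) \<Rightarrow> nat \<Rightarrow> ('a \<Rightarrow> complex mat) \<Rightarrow> bool" where
  "equivalent_reps G m \<rho> n \<sigma> \<longleftrightarrow>
     (\<exists>T\<in>carrier_mat n m. invertible_mat T \<and> (\<forall>x\<in>carrier G. T * \<rho> x = \<sigma> x * T))"

definition complete_irreps ::
    "('a, 'b) monoid_scheme \<Rightarrow> nat \<Rightarrow> (nat \<Rightarrow> nat) \<Rightarrow> (nat \<Rightarrow> 'a \<Rightarrow> complex mat) \<Rightarrow> bool" where
  "complete_irreps G k d \<pi> \<longleftrightarrow>
     (\<forall>r\<in>{1..k}. irreducible_unitary_rep G (d r) (\<pi> r)) \<and>
     (\<forall>r\<in>{1..k}. \<forall>s\<in>{1..k}. r \<noteq> s \<longrightarrow> \<not> equivalent_reps G (d r) (\<pi> r) (d s) (\<pi> s)) \<and>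
     (\<forall>n \<rho>. irreducible_unitary_rep G n \<rho> \<longrightarrow>
        (\<exists>r\<in>{1..k}. equivalent_reps G n \<rho> (d r) (\<pi> r)))"

definition mat_trace :: "complex mat \<Rightarrow> complex" where
  "mat_trace A = (\<Sum>i<dim_row A. A $$ (i, i))"

definition rep_character :: "('a \<Rightarrow> complex mat) \<Rightarrow> 'a \<Rightarrow> complex" where
  "rep_character \<rho> x = mat_trace (\<rho> x)"

section \<open>The space of complex functions on a finite group\<close>

text \<open>Elements of \<open>L\<^sup>2(G)\<close> are functions on the whole type \<open>'a\<close>, of which only the values on
  \<open>carrier G\<close> enter the inner product, the norm and convolutions at points of \<open>carrier G\<close>.\<close>

definition L2_inner ::
    "('a, 'b) monoid_scheme \<Rightarrow> ('a \<Rightarrow> complex) \<Rightarrow> ('a \<Rightarrow> complex) \<Rightarrow> complex" where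
  "L2_inner G f g = 1 / of_nat (card (carrier G)) * (\<Sum>x\<in>carrier G. f x * cnj (g x))"

definition L2_norm :: "('a, 'b) monoid_scheme \<Rightarrow> ('a \<Rightarrow> complex) \<Rightarrow> real" where
  "L2_norm G f = sqrt (Re (L2_inner G f f))"

definition convolution ::
    "('a, 'b) monoid_scheme \<Rightarrow> ('a \<Rightarrow> complex) \<Rightarrow> ('a \<Rightarrow> complex) \<Rightarrow> 'a \<Rightarrow> complex" where
  "convolution G f g x =
     1 / of_nat (card (carrier G)) * (\<Sum>y\<in>carrier G. f y * g (inv\<^bsub>G\<^esub> y \<otimes>\<^bsub>G\<^esub> x))"

section \<open>Wavelets and the scattering transform\<close>

text \<open>A kernel is a function \<open>\<gamma>\<close> with \<open>\<gamma> j r\<close> standing for \<open>\<gamma>\<^sub>j(r)\<close>; only the values with \<open>j \<le> J\<close> and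
  \<open>1 \<le> r \<le> k\<close> are used.\<close>

definition kernel_beta :: "nat \<Rightarrow> (nat \<Rightarrow> nat \<Rightarrow> complex) \<Rightarrow> real" where
  "kernel_beta k \<gamma> = Min ((\<lambda>r. (cmod (\<gamma> 0 r))\<^sup>2) ` {1..k})"

definition admissible_kernel :: "nat \<Rightarrow> nat \<Rightarrow> (nat \<Rightarrow> nat \<Rightarrow> complex) \<Rightarrow> bool" where
  "admissible_kernel J k \<gamma> \<longleftrightarrow>
     (\<forall>r\<in>{1..k}. (\<Sum>j=1..J. (cmod (\<gamma> j r))\<^sup>2) = 1 - (cmod (\<gamma> 0 r))\<^sup>2) \<and>
     kernel_beta k \<gamma> > 0"

definition wavelet ::
    "nat \<Rightarrow> (nat \<Rightarrow> nat) \<Rightarrow> (nat \<Rightarrow> 'a \<Rightarrow> complex mat) \<Rightarrow> (nat \<Rightarrow> nat \<Rightarrow> complex) \<Rightarrow> nat \<Rightarrow> 'a \<Rightarrow> complex"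
  where
  "wavelet k d \<pi> \<gamma> j x = (\<Sum>r=1..k. of_nat (d r) * \<gamma> j r * rep_character (\<pi> r) x)"

text \<open>The path \<open>(j\<^sub>1, \<dots>, j\<^sub>m)\<close> is the list \<open>[j\<^sub>1, \<dots>, j\<^sub>m]\<close>; its head \<open>j\<^sub>1\<close> is applied first.\<close>

definition scattering_paths :: "nat \<Rightarrow> nat list set" where
  "scattering_paths J = (\<Union>m. {p. length p = m \<and> set p \<subseteq> {1..J}})"

primrec scattering_U ::
    "('a, 'b) monoid_scheme \<Rightarrow> (nat \<Rightarrow> 'a \<Rightarrow> complex) \<Rightarrow> nat list \<Rightarrow> ('a \<Rightarrow> complex) \<Rightarrow> 'a \<Rightarrow> complex"
  where
  "scattering_U G \<psi> [] f = f"
| "scattering_U G \<psi> (j # p) f =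
     scattering_U G \<psi> p (\<lambda>x. complex_of_real (cmod (convolution G (\<psi> j) f x)))"

definition scattering_S ::
    "('a, 'b) monoid_scheme \<Rightarrow> (nat \<Rightarrow> 'a \<Rightarrow> complex) \<Rightarrow> nat list \<Rightarrow> ('a \<Rightarrow> complex) \<Rightarrow> 'a \<Rightarrow> complex"
  where
  "scattering_S G \<psi> p f = convolution G (\<psi> 0) (scattering_U G \<psi> p f)"

text \<open>\<^const>\<open>infsum\<close> is \<open>0\<close> on families that are not summable, so a claim about \<open>path_family_norm\<close>
  is meaningful only together with \<open>path_family_finite_norm\<close>.\<close>

definition path_family_finite_norm ::
    "('a, 'b) monoid_scheme \<Rightarrow> nat \<Rightarrow> (nat list \<Rightarrow> 'a \<Rightarrow> complex) \<Rightarrow> bool" where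
  "path_family_finite_norm G J F \<longleftrightarrow>
     (\<lambda>p. (L2_norm G (F p))\<^sup>2) summable_on scattering_paths J"

definition path_family_norm ::
    "('a, 'b) monoid_scheme \<Rightarrow> nat \<Rightarrow> (nat list \<Rightarrow> 'a \<Rightarrow> complex) \<Rightarrow> real" where
  "path_family_norm G J F = sqrt (\<Sum>\<^sub>\<infinity>p\<in>scattering_paths J. (L2_norm G (F p))\<^sup>2)"

end

theory Submission
  imports Defs "Jordan_Normal_Form.Spectral_Radius"
begin

text \<open>
  The proof has a harmonic-analysis part and an energy argument.

  Put \<open>e\<^sub>r = d\<^sub>r \<chi>\<^sup>r\<close> (\<open>isotypic r\<close> below). By Schur orthogonality, \<open>e\<^sub>r * e\<^sub>s\<close> is \<open>e\<^sub>s\<close> if \<open>r = s\<close> and \<open>0\<close> otherwise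
  (\<open>isotypic_convolution\<close>), and \<open>e\<^sub>r(x\<^sup>-\<^sup>1)\<close> is the complex conjugate of \<open>e\<^sub>r(x)\<close>, so that the operators
  \<open>f \<mapsto> e\<^sub>r * f\<close> are pairwise orthogonal projections. They add up to the identity
  (\<open>sum_isotypic\<close>): the sum of the \<open>e\<^sub>r\<close> acts as the identity on every irreducible
  representation, hence by complete reducibility on every unitary representation, in particular on the
  regular one, which forces it to be the unit of convolution. Consequently
  \<open>\<parallel>\<psi>\<^sub>j * f\<parallel>\<^sup>2 = \<Sum>\<^sub>r |\<gamma>\<^sub>j(r)|\<^sup>2 \<parallel>e\<^sub>r * f\<parallel>\<^sup>2\<close> and \<open>\<parallel>f\<parallel>\<^sup>2 = \<Sum>\<^sub>r \<parallel>e\<^sub>r * f\<parallel>\<^sup>2\<close>. Admissibility of the kernel then says that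
  \<open>\<parallel>f\<parallel>\<^sup>2\<close> is the sum of all \<open>\<parallel>\<psi>\<^sub>j * f\<parallel>\<^sup>2\<close> with \<open>0 \<le> j \<le> J\<close> (\<open>wavelet_energy\<close>) and that
  \<open>\<parallel>\<phi> * f\<parallel>\<^sup>2 \<ge> \<beta> \<parallel>f\<parallel>\<^sup>2\<close> (\<open>low_pass_energy_ge\<close>).

  Taking the modulus does not change norms, so the energy of \<open>f\<close> is the energy of \<open>S[p]f\<close> over all paths
  of length less than \<open>m\<close> plus the energy of \<open>U[p]f\<close> over all paths of length \<open>m\<close>
  (\<open>scattering_energy\<close>). Each propagation step keeps at most the fraction \<open>1 - \<beta> < 1\<close> of the
  energy (\<open>propagated_energy_decay\<close>), so the second term tends to \<open>0\<close> as \<open>m\<close> grows.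

  The representation theory is elementary. Schur's lemma needs only an eigenvalue of a complex
  matrix. Subspaces enter through orthonormal bases, recorded as matrices \<open>V\<close> with \<open>V\<^sup>* V = 1\<close>, and
  dimensions are compared by taking traces of the projections \<open>V V\<^sup>*\<close>.
\<close>

section \<open>Adjoints, traces and isometries of complex matrices\<close>

lemma mat_adjoint_carrier [intro]:
  "A \<in> carrier_mat n m \<Longrightarrow> mat_adjoint A \<in> carrier_mat m n"
  unfolding mat_adjoint_def by auto

lemma mat_adjoint_dim [simp]:
  "dim_row (mat_adjoint A) = dim_col A" "dim_col (mat_adjoint A) = dim_row A"
  unfolding mat_adjoint_def by auto

lemma mat_adjoint_index:
  assumes "A \<in> carrier_mat n m" "i < m" "j < n"
  shows "mat_adjoint A $$ (i, j) = cnj (A $$ (j, i))"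
  using assms by (auto simp: mat_adjoint_def mat_of_rows_index)

lemma mat_mult_index:
  assumes "A \<in> carrier_mat n m" "B \<in> carrier_mat m l" "i < n" "j < l"
  shows "(A * B) $$ (i, j) = (\<Sum>k<m. A $$ (i, k) * B $$ (k, j))"
  using assms by (auto simp: scalar_prod_def atLeast0LessThan)

lemma mat_adjoint_adjoint:
  assumes "(A :: complex mat) \<in> carrier_mat n m"
  shows "mat_adjoint (mat_adjoint A) = A"
proof (rule eq_matI)
  fix i j assume "i < dim_row A" "j < dim_col A"
  then show "mat_adjoint (mat_adjoint A) $$ (i, j) = A $$ (i, j)"
    using assms mat_adjoint_index[OF mat_adjoint_carrier[OF assms], of i j]
      mat_adjoint_index[OF assms, of j i] by auto
qed (use assms in auto)

lemma mat_adjoint_mult: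
  assumes A: "(A :: complex mat) \<in> carrier_mat n m" and B: "B \<in> carrier_mat m l"
  shows "mat_adjoint (A * B) = mat_adjoint B * mat_adjoint A"
proof (rule eq_matI)
  fix i j
  assume "i < dim_row (mat_adjoint B * mat_adjoint A)" "j < dim_col (mat_adjoint B * mat_adjoint A)"
  then have ij: "i < l" "j < n"
    using mat_adjoint_carrier[OF A] mat_adjoint_carrier[OF B] by auto
  have "mat_adjoint (A * B) $$ (i, j) = cnj (\<Sum>k<m. A $$ (j, k) * B $$ (k, i))"
    using mat_adjoint_index[OF mult_carrier_mat[OF A B] ij] mat_mult_index[OF A B ij(2,1)] by simp
  also have "\<dots> = (\<Sum>k<m. mat_adjoint B $$ (i, k) * mat_adjoint A $$ (k, j))"
    unfolding cnj_sum
    by (rule sum.cong)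
      (use ij mat_adjoint_index[OF A] mat_adjoint_index[OF B] in \<open>auto simp: mult.commute\<close>)
  also have "\<dots> = (mat_adjoint B * mat_adjoint A) $$ (i, j)"
    using mat_mult_index[OF mat_adjoint_carrier[OF B] mat_adjoint_carrier[OF A] ij] by simp
  finally show "mat_adjoint (A * B) $$ (i, j) = (mat_adjoint B * mat_adjoint A) $$ (i, j)" .
qed (use mat_adjoint_carrier[OF mult_carrier_mat[OF A B]] mat_adjoint_carrier[OF A]
       mat_adjoint_carrier[OF B] in auto)

lemma mat_adjoint_zero: "mat_adjoint (0\<^sub>m n m) = (0\<^sub>m m n :: complex mat)"
  by (rule eq_matI) (auto simp: mat_adjoint_index[OF zero_carrier_mat])

lemma mat_trace_carrier: "A \<in> carrier_mat n n \<Longrightarrow> mat_trace A = (\<Sum>i<n. A $$ (i, i))"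
  by (simp add: mat_trace_def)

lemma mat_trace_mult:
  assumes A: "A \<in> carrier_mat n m" and B: "B \<in> carrier_mat m n"
  shows "mat_trace (A * B) = (\<Sum>i<n. \<Sum>k<m. A $$ (i, k) * B $$ (k, i))"
  by (simp add: mat_trace_carrier[OF mult_carrier_mat[OF A B]] mat_mult_index[OF A B]
      del: index_mult_mat)

lemma mat_trace_mult_comm:
  assumes A: "A \<in> carrier_mat n m" and B: "B \<in> carrier_mat m n"
  shows "mat_trace (A * B) = mat_trace (B * A)"
  unfolding mat_trace_mult[OF A B] mat_trace_mult[OF B A]
  by (subst sum.swap) (simp add: mult.commute)

lemma adjoint_mult_self_index:
  assumes A: "A \<in> carrier_mat n m" and "j < m"
  shows "(mat_adjoint A * A) $$ (j, j) = complex_of_real (\<Sum>i<n. (cmod (A $$ (i, j)))\<^sup>2)"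
proof -
  have "(mat_adjoint A * A) $$ (j, j) = (\<Sum>i<n. cnj (A $$ (i, j)) * A $$ (i, j))"
    using mat_mult_index[OF mat_adjoint_carrier[OF A] A assms(2) assms(2)] mat_adjoint_index[OF A assms(2)]
    by simp
  then show ?thesis
    by (simp add: complex_norm_square[symmetric] mult.commute)
qed

lemma mat_eq_if_mult_vec_eq:
  assumes "A \<in> carrier_mat n m" "B \<in> carrier_mat n m"
    and "\<And>v. v \<in> carrier_vec m \<Longrightarrow> A *\<^sub>v v = B *\<^sub>v (v :: complex vec)"
  shows "A = B"
proof (rule eq_matI)
  fix i j assume "i < dim_row B" "j < dim_col B"
  then have ij: "i < n" "j < m" using assms(2) by auto
  have "(A *\<^sub>v unit_vec m j) $ i = (B *\<^sub>v unit_vec m j) $ i" by (simp add: assms(3))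
  then show "A $$ (i, j) = B $$ (i, j)"
    using ij assms(1,2) by (simp add: scalar_prod_right_unit)
qed (use assms in auto)

text \<open>The number of columns of an isometry is the trace of the projection onto its range; this
  replaces all dimension counting.\<close>

lemma mat_trace_isometry:
  assumes V: "(V :: complex mat) \<in> carrier_mat n m" and iso: "mat_adjoint V * V = 1\<^sub>m m"
  shows "mat_trace (V * mat_adjoint V) = of_nat m"
proof -
  have "mat_trace (V * mat_adjoint V) = mat_trace (mat_adjoint V * V)"
    by (rule mat_trace_mult_comm) (use V in auto)
  also have "\<dots> = of_nat m" unfolding iso by (simp add: mat_trace_def)
  finally show ?thesis .
qed

text \<open>The range projection \<open>Q = V V\<^sup>*\<close> satisfies \<open>Q\<^sub>i\<^sub>i = \<Sum>\<^sub>j |Q\<^sub>j\<^sub>i|\<^sup>2\<close>, so its diagonal entries are at most \<open>1\<close>.\<close>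

lemma isometry_columns_le:
  assumes V: "(V :: complex mat) \<in> carrier_mat n m" and iso: "mat_adjoint V * V = 1\<^sub>m m"
  shows "m \<le> n"
proof -
  define Q where "Q = V * mat_adjoint V"
  have aV: "mat_adjoint V \<in> carrier_mat m n" and Q: "Q \<in> carrier_mat n n"
    using V unfolding Q_def by auto
  have adjQ: "mat_adjoint Q = Q"
    unfolding Q_def mat_adjoint_mult[OF V aV] mat_adjoint_adjoint[OF V] ..
  have "mat_adjoint V * (V * mat_adjoint V) = mat_adjoint V"
    using assoc_mult_mat[OF aV V aV] left_mult_one_mat[OF aV] unfolding iso by simp
  then have QQ: "Q * Q = Q"
    using assoc_mult_mat[OF V aV Q] unfolding Q_def by simp
  have diag: "Re (Q $$ (i, i)) \<le> 1" if i: "i < n" for i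
  proof -
    have eq: "Q $$ (i, i) = complex_of_real (\<Sum>j<n. (cmod (Q $$ (j, i)))\<^sup>2)"
      using adjoint_mult_self_index[OF Q i] adjQ QQ by simp
    have "(cmod (Q $$ (i, i)))\<^sup>2 \<le> (\<Sum>j<n. (cmod (Q $$ (j, i)))\<^sup>2)"
      using i by (intro member_le_sum) auto
    also have "\<dots> = Re (Q $$ (i, i))" by (subst eq) simp
    finally have "(cmod (Q $$ (i, i)))\<^sup>2 \<le> cmod (Q $$ (i, i))"
      using complex_Re_le_cmod order_trans by blast
    then have "cmod (Q $$ (i, i)) \<le> 1"
      using mult_left_le_imp_le[of "cmod (Q $$ (i, i))" "cmod (Q $$ (i, i))" 1]
      by (cases "cmod (Q $$ (i, i)) = 0") (simp_all add: power2_eq_square)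
    then show ?thesis using complex_Re_le_cmod order_trans by blast
  qed
  have "real m = Re (mat_trace Q)" using mat_trace_isometry[OF V iso] by (simp add: Q_def)
  also have "\<dots> = (\<Sum>i<n. Re (Q $$ (i, i)))" by (simp add: mat_trace_carrier[OF Q])
  also have "\<dots> \<le> (\<Sum>i<n. 1)" by (rule sum_mono) (use diag in auto)
  finally show ?thesis by simp
qed

text \<open>Linear subspaces of the space of complex column vectors of length \<open>n\<close>, by elementwise closure
  conditions; the lemma below identifies them with the subspaces in the sense of modules over a
  field.\<close>

definition linear_subspace :: "nat \<Rightarrow> complex vec set \<Rightarrow> bool" where
  "linear_subspace n W \<longleftrightarrow> W \<subseteq> carrier_vec n \<and> 0\<^sub>v n \<in> W \<and>
     (\<forall>v\<in>W. \<forall>w\<in>W. v + w \<in> W) \<and> (\<forall>c. \<forall>v\<in>W. c \<cdot>\<^sub>v v \<in> W)"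

lemma linear_subspace_iff:
  "linear_subspace n W \<longleftrightarrow> VectorSpace.subspace class_ring W (module_vec TYPE(complex) n)"
  using vec_vs[where ?'a = complex, of n] vec_module[where ?'a = complex, of n]
  by (auto simp: linear_subspace_def VectorSpace.subspace_def submodule_def module_vec_simps class_ring_simps)

text \<open>Every subspace has an orthonormal basis, recorded as the columns of an isometry: an
  isometry into the subspace with the largest possible number of columns is onto.\<close>

lemma obtain_isometry_onto_subspace:
  assumes W: "linear_subspace n W"
  obtains m V where "V \<in> carrier_mat n m" "mat_adjoint V * V = 1\<^sub>m m"
    "\<And>c. c \<in> carrier_vec m \<Longrightarrow> V *\<^sub>v c \<in> W"
    "\<And>w. w \<in> W \<Longrightarrow> V *\<^sub>v (mat_adjoint V *\<^sub>v w) = w"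
proof -
  \<comment> \<open>\<open>P m\<close>: the subspace contains an orthonormal system of \<open>m\<close> vectors.\<close>
  define P where "P m \<longleftrightarrow> (\<exists>V\<in>carrier_mat n m. mat_adjoint V * V = 1\<^sub>m m \<and>
      (\<forall>c\<in>carrier_vec m. V *\<^sub>v c \<in> W))" for m
  have Wc: "W \<subseteq> carrier_vec n" and W0: "0\<^sub>v n \<in> W"
    and Wadd: "\<And>v w. v \<in> W \<Longrightarrow> w \<in> W \<Longrightarrow> v + w \<in> W" and Wsm: "\<And>c v. v \<in> W \<Longrightarrow> c \<cdot>\<^sub>v v \<in> W"
    using W unfolding linear_subspace_def by auto
  have "P 0"
    unfolding P_def
  proof (intro bexI[of _ "0\<^sub>m n 0"] conjI ballI)
    show "mat_adjoint (0\<^sub>m n 0) * 0\<^sub>m n 0 = (1\<^sub>m 0 :: complex mat)"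
      by (intro eq_matI) auto
    fix c :: "complex vec" assume "c \<in> carrier_vec 0"
    then have "0\<^sub>m n 0 *\<^sub>v c = 0\<^sub>v n" by (intro eq_vecI) (auto simp: scalar_prod_def)
    then show "0\<^sub>m n 0 *\<^sub>v c \<in> W" using W0 by simp
  qed auto
  moreover have "m \<le> n" if "P m" for m using that isometry_columns_le unfolding P_def by blast
  ultimately obtain m where m: "P m" and max: "\<And>k. P k \<Longrightarrow> k \<le> m"
    using GreatestI_nat[of P 0 n] Greatest_le_nat[of P _ n] by metis
  from m obtain V where V: "V \<in> carrier_mat n m" and iso: "mat_adjoint V * V = 1\<^sub>m m"
    and into: "\<And>c. c \<in> carrier_vec m \<Longrightarrow> V *\<^sub>v c \<in> W" unfolding P_def by blast
  have aV: "mat_adjoint V \<in> carrier_mat m n" using V by (rule mat_adjoint_carrier)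
  have "V *\<^sub>v (mat_adjoint V *\<^sub>v w) = w" if w: "w \<in> W" for w
  proof (rule ccontr)
    assume neq: "V *\<^sub>v (mat_adjoint V *\<^sub>v w) \<noteq> w"
    have wc: "w \<in> carrier_vec n" using w Wc by blast
    define a where "a = mat_adjoint V *\<^sub>v w"
    have a: "a \<in> carrier_vec m" and Va: "V *\<^sub>v a \<in> carrier_vec n"
      using aV V wc unfolding a_def by auto
    \<comment> \<open>The component of \<open>w\<close> orthogonal to the columns of \<open>V\<close>, once normalised, can be adjoined as a further column.\<close>
    define u where "u = w + (-1) \<cdot>\<^sub>v (V *\<^sub>v a)"
    have uW: "u \<in> W" unfolding u_def using w Wadd Wsm into a by blast
    have uc: "u \<in> carrier_vec n" using uW Wc by blast
    have "mat_adjoint V *\<^sub>v u = a + (-1) \<cdot>\<^sub>v ((mat_adjoint V * V) *\<^sub>v a)"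
      unfolding u_def using aV wc Va V a
      by (simp add: mult_add_distrib_mat_vec[of _ m n] mult_mat_vec[of _ m n] a_def[symmetric]
          assoc_mult_mat_vec[of _ m n _ m])
    also have "\<dots> = 0\<^sub>v m" unfolding iso using a by (intro eq_vecI) auto
    finally have Vu: "mat_adjoint V *\<^sub>v u = 0\<^sub>v m" .
    have orth: "(\<Sum>i<n. cnj (V $$ (i, j)) * u $ i) = 0" if j: "j < m" for j
    proof -
      have "(mat_adjoint V *\<^sub>v u) $ j = (\<Sum>i<n. cnj (V $$ (i, j)) * u $ i)"
        using j V uc by (auto simp: scalar_prod_def atLeast0LessThan mat_adjoint_index[OF V])
      then show ?thesis using Vu j by simp
    qed
    define s where "s = (\<Sum>i<n. (cmod (u $ i))\<^sup>2)"
    have "\<exists>i<n. u $ i \<noteq> 0"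
    proof (rule ccontr)
      assume "\<not> (\<exists>i<n. u $ i \<noteq> 0)"
      then have *: "u $ i = 0" if "i < n" for i using that by auto
      have "V *\<^sub>v a = w"
      proof (rule eq_vecI)
        fix i assume "i < dim_vec w"
        then have "i < n" "i < dim_vec (V *\<^sub>v a)" using wc V by auto
        then show "(V *\<^sub>v a) $ i = w $ i"
          using *[of i] wc unfolding u_def by (simp del: index_mult_mat_vec dim_mult_mat_vec)
      qed (use wc V in auto)
      then show False using neq by (simp add: a_def)
    qed
    then obtain l where "l < n" "u $ l \<noteq> 0" by blast
    then have s: "s > 0" unfolding s_def by (intro sum_pos2[of _ l]) auto
    define t where "t = 1 / sqrt s"
    have tt: "t * t = 1 / s" using s by (simp add: t_def)
    define q where "q = complex_of_real t \<cdot>\<^sub>v u"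
    have qW: "q \<in> W" unfolding q_def using uW Wsm by blast
    have qc: "q \<in> carrier_vec n" using qW Wc by blast
    have qi: "q $ i = complex_of_real t * u $ i" if "i < n" for i
      using that uc by (simp add: q_def)
    have Vq: "(\<Sum>i<n. cnj (V $$ (i, j)) * q $ i) = 0" if j: "j < m" for j
    proof -
      have "(\<Sum>i<n. cnj (V $$ (i, j)) * q $ i)
          = (\<Sum>i<n. complex_of_real t * (cnj (V $$ (i, j)) * u $ i))"
        by (rule sum.cong) (auto simp: qi)
      then show ?thesis using orth[OF j] by (simp only: sum_distrib_left[symmetric]) simp
    qed
    have qV: "(\<Sum>i<n. cnj (q $ i) * V $$ (i, j)) = 0" if j: "j < m" for j
      using arg_cong[OF Vq[OF j], of cnj] by (simp add: mult.commute)
    have "(\<Sum>i<n. cnj (q $ i) * q $ i) = (\<Sum>i<n. complex_of_real ((cmod (u $ i))\<^sup>2) / complex_of_real s)"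
    proof (rule sum.cong)
      fix i assume "i \<in> {..<n}"
      then have "cnj (q $ i) * q $ i = complex_of_real (t * t) * (u $ i * cnj (u $ i))"
        by (simp add: qi)
      also have "\<dots> = complex_of_real ((cmod (u $ i))\<^sup>2) / complex_of_real s"
        unfolding tt by (simp add: complex_norm_square[symmetric])
      finally show "cnj (q $ i) * q $ i = complex_of_real ((cmod (u $ i))\<^sup>2) / complex_of_real s" .
    qed simp
    also have "\<dots> = complex_of_real s / complex_of_real s"
      unfolding s_def of_real_sum sum_divide_distrib ..
    finally have qq: "(\<Sum>i<n. cnj (q $ i) * q $ i) = 1" using s by simp
    define V' where "V' = mat n (Suc m) (\<lambda>(i, j). if j < m then V $$ (i, j) else q $ i)"
    have V': "V' \<in> carrier_mat n (Suc m)" unfolding V'_def by simp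
    have "mat_adjoint V' * V' = 1\<^sub>m (Suc m)"
    proof (rule eq_matI)
      fix i j assume "i < dim_row (1\<^sub>m (Suc m) :: complex mat)" "j < dim_col (1\<^sub>m (Suc m) :: complex mat)"
      then have ij: "i < Suc m" "j < Suc m" by auto
      have e: "(mat_adjoint V' * V') $$ (i, j) = (\<Sum>l<n. cnj (V' $$ (l, i)) * V' $$ (l, j))"
        using mat_mult_index[OF mat_adjoint_carrier[OF V'] V' ij] ij by (simp add: mat_adjoint_index[OF V'])
      consider "i < m" "j < m" | "i < m" "j = m" | "i = m" "j < m" | "i = m" "j = m" using ij by linarith
      then show "(mat_adjoint V' * V') $$ (i, j) = 1\<^sub>m (Suc m) $$ (i, j)"
      proof cases
        case 1
        have "(\<Sum>l<n. cnj (V $$ (l, i)) * V $$ (l, j)) = (mat_adjoint V * V) $$ (i, j)"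
          using mat_mult_index[OF aV V 1] 1 by (simp add: mat_adjoint_index[OF V])
        then show ?thesis unfolding e using 1 iso by (simp add: V'_def)
      next
        case 2 then show ?thesis unfolding e using Vq[of i] by (simp add: V'_def)
      next
        case 3 then show ?thesis unfolding e using qV[of j] by (simp add: V'_def)
      next
        case 4 then show ?thesis unfolding e using qq by (simp add: V'_def)
      qed
    qed (use mat_adjoint_carrier[OF V'] V' in auto)
    moreover have "V' *\<^sub>v c \<in> W" if c: "c \<in> carrier_vec (Suc m)" for c
    proof -
      define c' where "c' = vec m (\<lambda>i. c $ i)"
      have c': "c' \<in> carrier_vec m" by (simp add: c'_def)
      have "V' *\<^sub>v c = V *\<^sub>v c' + (c $ m) \<cdot>\<^sub>v q"
        using V V' c qc
        by (intro eq_vecI) (auto simp: scalar_prod_def V'_def c'_def mult.commute)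
      then show ?thesis using into[OF c'] qW Wadd Wsm by simp
    qed
    ultimately have "P (Suc m)" unfolding P_def using V' by blast
    then show False using max[of "Suc m"] by simp
  qed
  then show ?thesis using that[OF V iso into] by blast
qed

text \<open>A proper nonzero subspace \<open>W\<close> (the range of \<open>V\<close>) and its orthogonal complement (the range of \<open>V'\<close>),
  both of dimension less than \<open>n\<close>.\<close>

lemma obtain_orthogonal_splitting:
  assumes W: "linear_subspace n W" and ne0: "W \<noteq> {0\<^sub>v n}" and neU: "W \<noteq> carrier_vec n"
  obtains m V m' V' where
    "V \<in> carrier_mat n m" "mat_adjoint V * V = 1\<^sub>m m" "m < n"
    "V' \<in> carrier_mat n m'" "mat_adjoint V' * V' = 1\<^sub>m m'" "m' < n"
    "V * mat_adjoint V + V' * mat_adjoint V' = 1\<^sub>m n" "mat_adjoint V * V' = 0\<^sub>m m m'"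
    "\<And>c. c \<in> carrier_vec m \<Longrightarrow> V *\<^sub>v c \<in> W"
    "\<And>w. w \<in> W \<Longrightarrow> V *\<^sub>v (mat_adjoint V *\<^sub>v w) = w"
proof -
  obtain m V where V: "V \<in> carrier_mat n m" and iso: "mat_adjoint V * V = 1\<^sub>m m"
    and into: "\<And>c. c \<in> carrier_vec m \<Longrightarrow> V *\<^sub>v c \<in> W"
    and onto: "\<And>w. w \<in> W \<Longrightarrow> V *\<^sub>v (mat_adjoint V *\<^sub>v w) = w"
    using obtain_isometry_onto_subspace[OF W] by metis
  have aV: "mat_adjoint V \<in> carrier_mat m n" using V by (rule mat_adjoint_carrier)
  \<comment> \<open>the orthogonal complement of \<open>W\<close>\<close>
  define W' where "W' = {v \<in> carrier_vec n. mat_adjoint V *\<^sub>v v = 0\<^sub>v m}"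
  have "linear_subspace n W'"
    unfolding linear_subspace_def W'_def using aV
    by (auto simp: mult_add_distrib_mat_vec[of _ m n] mult_mat_vec[of _ m n] intro!: eq_vecI simp: scalar_prod_def)
  then obtain m' V' where V': "V' \<in> carrier_mat n m'" and iso': "mat_adjoint V' * V' = 1\<^sub>m m'"
    and into': "\<And>c. c \<in> carrier_vec m' \<Longrightarrow> V' *\<^sub>v c \<in> W'"
    and onto': "\<And>w. w \<in> W' \<Longrightarrow> V' *\<^sub>v (mat_adjoint V' *\<^sub>v w) = w"
    using obtain_isometry_onto_subspace by metis
  have aV': "mat_adjoint V' \<in> carrier_mat m' n" using V' by (rule mat_adjoint_carrier)
  have VV': "mat_adjoint V * V' = 0\<^sub>m m m'"
  proof (rule mat_eq_if_mult_vec_eq[of _ m m'])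
    fix v :: "complex vec" assume v: "v \<in> carrier_vec m'"
    have "(mat_adjoint V * V') *\<^sub>v v = 0\<^sub>v m"
      using into'[OF v] assoc_mult_mat_vec[OF aV V' v] unfolding W'_def by simp
    then show "(mat_adjoint V * V') *\<^sub>v v = 0\<^sub>m m m' *\<^sub>v v" using v by auto
  qed (use aV V' in auto)
  have "mat_adjoint (mat_adjoint V * V') = mat_adjoint V' * V"
    unfolding mat_adjoint_mult[OF aV V'] mat_adjoint_adjoint[OF V] ..
  then have V'V: "mat_adjoint V' * V = 0\<^sub>m m' m"
    by (simp only: VV' mat_adjoint_zero)
  have sum1: "V * mat_adjoint V + V' * mat_adjoint V' = 1\<^sub>m n"
  proof (rule mat_eq_if_mult_vec_eq[of _ n n])
    fix v :: "complex vec" assume v: "v \<in> carrier_vec n"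
    define a where "a = mat_adjoint V *\<^sub>v v"
    have a: "a \<in> carrier_vec m" using aV v unfolding a_def by auto
    have Va: "V *\<^sub>v a \<in> carrier_vec n" using V a by auto
    define u where "u = v + (-1) \<cdot>\<^sub>v (V *\<^sub>v a)"
    have u: "u \<in> carrier_vec n" using v Va by (simp add: u_def)
    have "mat_adjoint V *\<^sub>v u = a + (-1) \<cdot>\<^sub>v ((mat_adjoint V * V) *\<^sub>v a)"
      unfolding u_def using aV v Va V a
      by (simp add: mult_add_distrib_mat_vec[of _ m n] mult_mat_vec[of _ m n] a_def[symmetric]
          assoc_mult_mat_vec[of _ m n _ m])
    also have "\<dots> = 0\<^sub>v m" unfolding iso using a by (intro eq_vecI) auto
    finally have "u \<in> W'" using u by (simp add: W'_def)
    then have 1: "V' *\<^sub>v (mat_adjoint V' *\<^sub>v u) = u" by (rule onto')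
    have "mat_adjoint V' *\<^sub>v u = mat_adjoint V' *\<^sub>v v + (-1) \<cdot>\<^sub>v ((mat_adjoint V' * V) *\<^sub>v a)"
      unfolding u_def using aV' v Va V a
      by (simp add: mult_add_distrib_mat_vec[of _ m' n] mult_mat_vec[of _ m' n]
          assoc_mult_mat_vec[of _ m' n _ m])
    also have "\<dots> = mat_adjoint V' *\<^sub>v v" unfolding V'V using a v aV' by (intro eq_vecI) auto
    finally have 2: "V' *\<^sub>v (mat_adjoint V' *\<^sub>v v) = u" using 1 by simp
    have "(V * mat_adjoint V + V' * mat_adjoint V') *\<^sub>v v
        = V *\<^sub>v a + V' *\<^sub>v (mat_adjoint V' *\<^sub>v v)"
      unfolding a_def using V aV V' aV' v
      by (simp add: add_mult_distrib_mat_vec[of _ n n] assoc_mult_mat_vec[of _ n m _ n]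
          assoc_mult_mat_vec[of _ n m' _ n])
    also have "\<dots> = v"
      unfolding 2 u_def using v Va by (intro eq_vecI) (auto simp del: index_mult_mat_vec dim_mult_mat_vec)
    finally show "(V * mat_adjoint V + V' * mat_adjoint V') *\<^sub>v v = 1\<^sub>m n *\<^sub>v v" using v by simp
  qed (use V aV V' aV' in auto)
  \<comment> \<open>Traces give \<open>n = m + m'\<close>; it remains to see that neither part is trivial.\<close>
  have "mat_trace (V * mat_adjoint V + V' * mat_adjoint V')
      = mat_trace (V * mat_adjoint V) + mat_trace (V' * mat_adjoint V')"
    using V aV V' aV' by (simp add: mat_trace_def sum.distrib del: index_mult_mat(1))
  then have "of_nat n = (of_nat m + of_nat m' :: complex)"
    unfolding sum1 mat_trace_isometry[OF V iso] mat_trace_isometry[OF V' iso'] by (simp add: mat_trace_def)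
  then have n: "n = m + m'" by (metis of_nat_add of_nat_eq_iff)
  have "m \<noteq> 0"
  proof
    assume m0: "m = 0"
    have "w = 0\<^sub>v n" if w: "w \<in> W" for w
    proof -
      have "V *\<^sub>v (mat_adjoint V *\<^sub>v w) = 0\<^sub>v n"
        using V aV m0 by (intro eq_vecI) (auto simp: scalar_prod_def)
      then show ?thesis using onto[OF w] by simp
    qed
    then show False using ne0 W unfolding linear_subspace_def by blast
  qed
  moreover have "m' \<noteq> 0"
  proof
    assume m0: "m' = 0"
    have z: "V' * mat_adjoint V' = 0\<^sub>m n n"
      using V' aV' m0 by (intro eq_matI) (auto simp: scalar_prod_def)
    have "w \<in> W" if w: "w \<in> carrier_vec n" for w
    proof -
      have "w = (V * mat_adjoint V) *\<^sub>v w" using sum1 z V aV w by simp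
      also have "\<dots> = V *\<^sub>v (mat_adjoint V *\<^sub>v w)" using V aV w by (simp add: assoc_mult_mat_vec[of _ n m _ n])
      finally show ?thesis using into[of "mat_adjoint V *\<^sub>v w"] aV w by simp
    qed
    then show False using neU W unfolding linear_subspace_def by blast
  qed
  ultimately show ?thesis
    using n by (intro that[OF V iso _ V' iso' _ sum1 VV' into onto]) auto
qed

section \<open>Unitary representations and Schur's lemma\<close>

locale finite_group = group G for G :: "('a, 'b) monoid_scheme" (structure) +
  assumes finite_carrier: "finite (carrier G)"
begin

lemma card_carrier_pos: "card (carrier G) > 0"
  using finite_carrier one_closed by (auto simp: card_gt_0_iff)

lemma sum_left_translate:
  assumes "z \<in> carrier G"
  shows "(\<Sum>x\<in>carrier G. h (z \<otimes> x)) = (\<Sum>x\<in>carrier G. h x)"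
  by (rule sum.reindex_bij_witness[of _ "\<lambda>x. inv z \<otimes> x" "\<lambda>x. z \<otimes> x"])
    (use assms in \<open>auto simp: m_assoc[symmetric]\<close>)

lemma sum_inv: "(\<Sum>x\<in>carrier G. h (inv x)) = (\<Sum>x\<in>carrier G. h x)"
  by (rule sum.reindex_bij_witness[of _ "\<lambda>x. inv x" "\<lambda>x. inv x"]) auto

lemma
  assumes "unitary_rep G n \<rho>"
  shows unitary_rep_carrier: "x \<in> carrier G \<Longrightarrow> \<rho> x \<in> carrier_mat n n"
    and unitary_rep_mult: "x \<in> carrier G \<Longrightarrow> y \<in> carrier G \<Longrightarrow> \<rho> (x \<otimes> y) = \<rho> x * \<rho> y"
    and unitary_rep_one: "\<rho> \<one> = 1\<^sub>m n"
    and unitary_rep_adjoint: "x \<in> carrier G \<Longrightarrow> mat_adjoint (\<rho> x) = \<rho> (inv x)"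
proof -
  have c: "\<rho> x \<in> carrier_mat n n"
    and u1: "\<rho> x * mat_adjoint (\<rho> x) = 1\<^sub>m n" and u2: "mat_adjoint (\<rho> x) * \<rho> x = 1\<^sub>m n"
    if "x \<in> carrier G" for x
    using assms that unfolding unitary_rep_def hom_def unitary_group_def inverts_mat_def by (auto simp: Pi_iff)
  have m: "\<rho> (x \<otimes> y) = \<rho> x * \<rho> y" if "x \<in> carrier G" "y \<in> carrier G" for x y
    using assms that unfolding unitary_rep_def hom_def unitary_group_def by auto
  have one: "\<rho> \<one> = 1\<^sub>m n"
  proof -
    have "\<rho> \<one> = (mat_adjoint (\<rho> \<one>) * \<rho> \<one>) * \<rho> \<one>" using u2[of \<one>] c[of \<one>] by simp
    also have "\<dots> = mat_adjoint (\<rho> \<one>) * (\<rho> \<one> * \<rho> \<one>)"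
      using c[of \<one>] by (intro assoc_mult_mat) auto
    also have "\<rho> \<one> * \<rho> \<one> = \<rho> \<one>" using m[of \<one> \<one>] by simp
    also have "mat_adjoint (\<rho> \<one>) * \<rho> \<one> = 1\<^sub>m n" using u2 by simp
    finally show ?thesis .
  qed
  have "mat_adjoint (\<rho> x) = \<rho> (inv x)" if x: "x \<in> carrier G" for x
  proof -
    have "mat_adjoint (\<rho> x) = mat_adjoint (\<rho> x) * (\<rho> x * \<rho> (inv x))"
      using m[of x "inv x", symmetric] x one right_mult_one_mat[OF mat_adjoint_carrier[OF c[OF x]]] by simp
    also have "\<dots> = (mat_adjoint (\<rho> x) * \<rho> x) * \<rho> (inv x)"
      using c x by (intro assoc_mult_mat[symmetric, of _ n n _ n _ n]) auto
    also have "\<dots> = \<rho> (inv x)" unfolding u2[OF x] by (rule left_mult_one_mat[OF c]) (use x in simp)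
    finally show ?thesis .
  qed
  then show "x \<in> carrier G \<Longrightarrow> \<rho> x \<in> carrier_mat n n"
    "x \<in> carrier G \<Longrightarrow> y \<in> carrier G \<Longrightarrow> \<rho> (x \<otimes> y) = \<rho> x * \<rho> y"
    "\<rho> \<one> = 1\<^sub>m n" "x \<in> carrier G \<Longrightarrow> mat_adjoint (\<rho> x) = \<rho> (inv x)"
    using c m one by auto
qed

lemma unitary_repI:
  assumes c: "\<And>x. x \<in> carrier G \<Longrightarrow> \<rho> x \<in> carrier_mat n n"
    and m: "\<And>x y. x \<in> carrier G \<Longrightarrow> y \<in> carrier G \<Longrightarrow> \<rho> (x \<otimes> y) = \<rho> x * \<rho> y"
    and one: "\<rho> \<one> = 1\<^sub>m n"
    and adj: "\<And>x. x \<in> carrier G \<Longrightarrow> mat_adjoint (\<rho> x) = \<rho> (inv x)"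
  shows "unitary_rep G n \<rho>"
proof -
  have "\<rho> x * \<rho> (inv x) = 1\<^sub>m n" "\<rho> (inv x) * \<rho> x = 1\<^sub>m n" if "x \<in> carrier G" for x
    using that m[of x "inv x"] m[of "inv x" x] one by auto
  then show ?thesis
    using assms c[OF inv_closed]
    unfolding unitary_rep_def hom_def unitary_group_def inverts_mat_def by (auto simp: Pi_iff)
qed

lemma irreducible_unitary_repD:
  assumes "irreducible_unitary_rep G n \<rho>"
  shows "unitary_rep G n \<rho>" "n > 0"
    "linear_subspace n W \<Longrightarrow> (\<And>x v. x \<in> carrier G \<Longrightarrow> v \<in> W \<Longrightarrow> \<rho> x *\<^sub>v v \<in> W) \<Longrightarrow>
       W = {0\<^sub>v n} \<or> W = carrier_vec n"
  using assms
  unfolding irreducible_unitary_rep_def invariant_subspace_def linear_subspace_iff by auto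

lemma not_irreducible_unitary_repE:
  assumes "unitary_rep G n \<rho>" "n > 0" "\<not> irreducible_unitary_rep G n \<rho>"
  obtains W where "linear_subspace n W" "\<And>x v. x \<in> carrier G \<Longrightarrow> v \<in> W \<Longrightarrow> \<rho> x *\<^sub>v v \<in> W"
    "W \<noteq> {0\<^sub>v n}" "W \<noteq> carrier_vec n"
  using assms
  unfolding irreducible_unitary_rep_def invariant_subspace_def linear_subspace_iff by auto

text \<open>Schur's lemma, endomorphism form: an eigenspace of an endomorphism is invariant, hence
  everything.\<close>

lemma schur_scalar:
  assumes irr: "irreducible_unitary_rep G n \<rho>" and A: "A \<in> carrier_mat n n"
    and comm: "\<And>x. x \<in> carrier G \<Longrightarrow> A * \<rho> x = \<rho> x * A"
  obtains c where "A = c \<cdot>\<^sub>m 1\<^sub>m n"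
proof -
  have n: "n > 0" and rep: "unitary_rep G n \<rho>" using irreducible_unitary_repD[OF irr] by auto
  obtain c where "eigenvalue A c"
    using spectrum_non_empty[OF A n] unfolding spectrum_def by auto
  then obtain v where v: "v \<in> carrier_vec n" "v \<noteq> 0\<^sub>v n" "A *\<^sub>v v = c \<cdot>\<^sub>v v"
    unfolding eigenvalue_def eigenvector_def using A by auto
  define W where "W = {v \<in> carrier_vec n. A *\<^sub>v v = c \<cdot>\<^sub>v v}"
  have lin: "linear_subspace n W"
    unfolding linear_subspace_def W_def using A
    by (auto simp: mult_add_distrib_mat_vec[of _ n n] mult_mat_vec[of _ n n] smult_add_distrib_vec[of _ n]
        smult_smult_assoc mult.commute)
  have inv: "\<rho> x *\<^sub>v v \<in> W" if x: "x \<in> carrier G" and v: "v \<in> W" for x v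
  proof -
    have c1: "\<rho> x \<in> carrier_mat n n" and v1: "v \<in> carrier_vec n" and v2: "A *\<^sub>v v = c \<cdot>\<^sub>v v"
      using unitary_rep_carrier[OF rep x] v unfolding W_def by auto
    have "A *\<^sub>v (\<rho> x *\<^sub>v v) = \<rho> x *\<^sub>v (A *\<^sub>v v)"
      using assoc_mult_mat_vec[OF A c1 v1] assoc_mult_mat_vec[OF c1 A v1] comm[OF x] by simp
    also have "\<dots> = c \<cdot>\<^sub>v (\<rho> x *\<^sub>v v)" unfolding v2 using c1 v1 by (rule mult_mat_vec)
    finally show ?thesis using c1 v1 unfolding W_def by auto
  qed
  have "W = carrier_vec n"
    using irreducible_unitary_repD(3)[OF irr lin inv] v unfolding W_def by blast
  then have "A *\<^sub>v unit_vec n j = c \<cdot>\<^sub>v unit_vec n j" for j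
    unfolding W_def using unit_vec_carrier by blast
  then have *: "(A *\<^sub>v unit_vec n j) $ i = (c \<cdot>\<^sub>v unit_vec n j) $ i" for i j by simp
  have "A = c \<cdot>\<^sub>m 1\<^sub>m n"
  proof (rule eq_matI)
    fix i j assume "i < dim_row (c \<cdot>\<^sub>m 1\<^sub>m n)" "j < dim_col (c \<cdot>\<^sub>m 1\<^sub>m n)"
    then show "A $$ (i, j) = (c \<cdot>\<^sub>m 1\<^sub>m n) $$ (i, j)"
      using *[of j i] A by (auto simp: scalar_prod_right_unit index_unit_vec)
  qed (use A in auto)
  then show ?thesis by (rule that)
qed

text \<open>Schur's lemma for two inequivalent representations. For an intertwiner \<open>T\<close>, both \<open>T\<^sup>* T\<close> and \<open>T T\<^sup>*\<close> are scalar by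
  the endomorphism form, so that a nonzero \<open>T\<close> is a multiple of a unitary matrix.\<close>

lemma schur_inequivalent:
  assumes irr: "irreducible_unitary_rep G n \<rho>" "irreducible_unitary_rep G m \<sigma>"
    and T: "T \<in> carrier_mat m n"
    and comm: "\<And>x. x \<in> carrier G \<Longrightarrow> T * \<rho> x = \<sigma> x * T"
    and ineq: "\<not> equivalent_reps G n \<rho> m \<sigma>"
  shows "T = 0\<^sub>m m n"
proof (rule ccontr)
  assume "T \<noteq> 0\<^sub>m m n"
  then obtain a b where ab: "a < m" "b < n" "T $$ (a, b) \<noteq> 0"
    using T by (metis carrier_matD index_zero_mat eq_matI)
  have rep: "unitary_rep G n \<rho>" "unitary_rep G m \<sigma>" using irreducible_unitary_repD irr by auto
  have aT: "mat_adjoint T \<in> carrier_mat n m" using T by (rule mat_adjoint_carrier)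
  note c1 = unitary_rep_carrier[OF rep(1)] and c2 = unitary_rep_carrier[OF rep(2)]
  have comm': "mat_adjoint T * \<sigma> x = \<rho> x * mat_adjoint T" if x: "x \<in> carrier G" for x
  proof -
    have "mat_adjoint (T * \<rho> (inv x)) = mat_adjoint (\<sigma> (inv x) * T)" using comm x by simp
    then show ?thesis
      using mat_adjoint_mult[OF T c1[of "inv x"]] mat_adjoint_mult[OF c2[of "inv x"] T] x
        unitary_rep_adjoint[OF rep(1), of "inv x"] unitary_rep_adjoint[OF rep(2), of "inv x"] by simp
  qed
  have "(mat_adjoint T * T) * \<rho> x = \<rho> x * (mat_adjoint T * T)" if x: "x \<in> carrier G" for x
  proof -
    have "(mat_adjoint T * T) * \<rho> x = mat_adjoint T * (\<sigma> x * T)"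
      using assoc_mult_mat[OF aT T c1[OF x]] comm[OF x] by simp
    also have "\<dots> = (\<rho> x * mat_adjoint T) * T"
      using assoc_mult_mat[OF aT c2[OF x] T] comm'[OF x] by simp
    finally show ?thesis using assoc_mult_mat[OF c1[OF x] aT T] by simp
  qed
  then obtain c where c: "mat_adjoint T * T = c \<cdot>\<^sub>m 1\<^sub>m n"
    using schur_scalar[OF irr(1), of "mat_adjoint T * T"] T aT by (metis mult_carrier_mat)
  have "(T * mat_adjoint T) * \<sigma> x = \<sigma> x * (T * mat_adjoint T)" if x: "x \<in> carrier G" for x
  proof -
    have "(T * mat_adjoint T) * \<sigma> x = T * (\<rho> x * mat_adjoint T)"
      using assoc_mult_mat[OF T aT c2[OF x]] comm'[OF x] by simp
    also have "\<dots> = (\<sigma> x * T) * mat_adjoint T"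
      using assoc_mult_mat[OF T c1[OF x] aT] comm[OF x] by simp
    finally show ?thesis using assoc_mult_mat[OF c2[OF x] T aT] by simp
  qed
  then obtain e where e: "T * mat_adjoint T = e \<cdot>\<^sub>m 1\<^sub>m m"
    using schur_scalar[OF irr(2), of "T * mat_adjoint T"] T aT by (metis mult_carrier_mat)
  have "(\<Sum>i<m. (cmod (T $$ (i, b)))\<^sup>2) > 0"
    using ab by (intro sum_pos2[of _ a]) auto
  then have c0: "c \<noteq> 0"
    using adjoint_mult_self_index[OF T ab(2)] ab(2) unfolding c by (auto simp flip: of_real_sum)
  have "c \<cdot>\<^sub>m T = T * (mat_adjoint T * T)" unfolding c mult_smult_distrib[OF T one_carrier_mat] right_mult_one_mat[OF T] ..
  also have "\<dots> = e \<cdot>\<^sub>m T"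
    unfolding assoc_mult_mat[OF T aT T, symmetric] e mult_smult_assoc_mat[OF one_carrier_mat T]
      left_mult_one_mat[OF T] ..
  finally have "(c \<cdot>\<^sub>m T) $$ (a, b) = (e \<cdot>\<^sub>m T) $$ (a, b)" by simp
  then have ec: "e = c" using ab T by simp
  have "mat_trace (mat_adjoint T * T) = mat_trace (T * mat_adjoint T)"
    by (rule mat_trace_mult_comm[OF aT T])
  then have "c * of_nat n = c * of_nat m" unfolding c e ec by (simp add: mat_trace_def mult.commute)
  then have nm: "n = m" using c0 by simp
  define S where "S = (1 / c) \<cdot>\<^sub>m mat_adjoint T"
  have "T * S = 1\<^sub>m m" "S * T = 1\<^sub>m n"
    using T aT c e ec c0 unfolding S_def
    by (auto simp: mult_smult_distrib[of _ m n] mult_smult_assoc_mat[of _ n m] intro!: eq_matI)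
  then have "invertible_mat T"
    unfolding invertible_mat_def inverts_mat_def using T nm by (auto simp: S_def intro!: exI[of _ S])
  then show False using ineq comm T unfolding equivalent_reps_def by blast
qed

text \<open>For the matrix unit \<open>E\<^sub>i\<^sub>j\<close>, the sum of \<open>\<sigma>(x) E\<^sub>i\<^sub>j \<rho>(x\<^sup>-\<^sup>1)\<close> over the group is an intertwiner from \<open>\<rho>\<close>
  to \<open>\<sigma>\<close>. Its entries are the sums that occur in the orthogonality relations.\<close>

lemma averaged_elementary_intertwines:
  assumes rep: "unitary_rep G n \<rho>" "unitary_rep G m \<sigma>" and ij: "i < m" "j < n"
  defines "T \<equiv> mat m n (\<lambda>(a, b). \<Sum>x\<in>carrier G. \<sigma> x $$ (a, i) * \<rho> (inv x) $$ (j, b))"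
  shows "T \<in> carrier_mat m n" "z \<in> carrier G \<Longrightarrow> T * \<rho> z = \<sigma> z * T"
proof -
  show T: "T \<in> carrier_mat m n" by (simp add: T_def)
  assume z: "z \<in> carrier G"
  note c1 = unitary_rep_carrier[OF rep(1)] and c2 = unitary_rep_carrier[OF rep(2)]
  show "T * \<rho> z = \<sigma> z * T"
  proof (rule eq_matI)
    fix a b assume "a < dim_row (\<sigma> z * T)" "b < dim_col (\<sigma> z * T)"
    then have ab: "a < m" "b < n" using T c2[OF z] by auto
    have "(\<sigma> z * T) $$ (a, b) = (\<Sum>k<m. \<sigma> z $$ (a, k) * (\<Sum>x\<in>carrier G. \<sigma> x $$ (k, i) * \<rho> (inv x) $$ (j, b)))"
      using mat_mult_index[OF c2[OF z] T ab] ab by (simp add: T_def)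
    also have "\<dots> = (\<Sum>x\<in>carrier G. (\<Sum>k<m. \<sigma> z $$ (a, k) * \<sigma> x $$ (k, i)) * \<rho> (inv x) $$ (j, b))"
      by (simp add: sum_distrib_left sum_distrib_right mult.assoc) (rule sum.swap)
    also have "\<dots> = (\<Sum>x\<in>carrier G. \<sigma> (z \<otimes> x) $$ (a, i) * \<rho> (inv (z \<otimes> x) \<otimes> z) $$ (j, b))"
      using z ij ab
      by (intro sum.cong) (auto simp: unitary_rep_mult[OF rep(2)] mat_mult_index[OF c2 c2] inv_mult_group m_assoc
          simp del: index_mult_mat)
    also have "\<dots> = (\<Sum>x\<in>carrier G. \<sigma> x $$ (a, i) * \<rho> (inv x \<otimes> z) $$ (j, b))"
      by (rule sum_left_translate[OF z])
    also have "\<dots> = (\<Sum>x\<in>carrier G. \<sigma> x $$ (a, i) * (\<Sum>k<n. \<rho> (inv x) $$ (j, k) * \<rho> z $$ (k, b)))"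
      using z ij ab
      by (intro sum.cong) (auto simp: unitary_rep_mult[OF rep(1)] mat_mult_index[OF c1 c1] simp del: index_mult_mat)
    also have "\<dots> = (\<Sum>k<n. (\<Sum>x\<in>carrier G. \<sigma> x $$ (a, i) * \<rho> (inv x) $$ (j, k)) * \<rho> z $$ (k, b))"
      by (simp add: sum_distrib_left sum_distrib_right mult.assoc) (rule sum.swap)
    also have "\<dots> = (T * \<rho> z) $$ (a, b)"
      using mat_mult_index[OF T c1[OF z] ab] ab by (simp add: T_def)
    finally show "(T * \<rho> z) $$ (a, b) = (\<sigma> z * T) $$ (a, b)" ..
  qed (use T c1[OF z] c2[OF z] in auto)
qed

lemma schur_orthogonality_inequivalent:
  assumes irr: "irreducible_unitary_rep G n \<rho>" "irreducible_unitary_rep G m \<sigma>"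
    and ineq: "\<not> equivalent_reps G n \<rho> m \<sigma>" and "i < m" "j < n" "a < m" "b < n"
  shows "(\<Sum>x\<in>carrier G. \<sigma> x $$ (a, i) * \<rho> (inv x) $$ (j, b)) = 0"
proof -
  have rep: "unitary_rep G n \<rho>" "unitary_rep G m \<sigma>" using irreducible_unitary_repD irr by auto
  define T where "T = mat m n (\<lambda>(a, b). \<Sum>x\<in>carrier G. \<sigma> x $$ (a, i) * \<rho> (inv x) $$ (j, b))"
  note av = averaged_elementary_intertwines[OF rep assms(4,5), folded T_def]
  have "T = 0\<^sub>m m n" by (rule schur_inequivalent[OF irr av ineq])
  then have "T $$ (a, b) = 0" using assms by simp
  then show ?thesis using assms by (simp add: T_def)
qed

lemma schur_orthogonality_same:
  assumes irr: "irreducible_unitary_rep G n \<rho>" and "i < n" "j < n" "a < n" "b < n"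
  shows "(\<Sum>x\<in>carrier G. \<rho> x $$ (a, i) * \<rho> (inv x) $$ (j, b))
    = (if a = b \<and> i = j then of_nat (card (carrier G)) / of_nat n else 0)"
proof -
  have rep: "unitary_rep G n \<rho>" and n: "n > 0" using irreducible_unitary_repD irr by auto
  note c1 = unitary_rep_carrier[OF rep]
  define T where "T = mat n n (\<lambda>(a, b). \<Sum>x\<in>carrier G. \<rho> x $$ (a, i) * \<rho> (inv x) $$ (j, b))"
  note av = averaged_elementary_intertwines[OF rep rep assms(2,3), folded T_def]
  obtain c where c: "T = c \<cdot>\<^sub>m 1\<^sub>m n" using schur_scalar[OF irr av] by blast
  \<comment> \<open>The scalar is found from the trace of \<open>T\<close>, which collapses because \<open>\<rho>(x\<^sup>-\<^sup>1) \<rho>(x) = 1\<close>.\<close>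
  have "of_nat n * c = mat_trace T" unfolding c by (simp add: mat_trace_def)
  also have "\<dots> = (\<Sum>x\<in>carrier G. \<Sum>k<n. \<rho> (inv x) $$ (j, k) * \<rho> x $$ (k, i))"
    by (simp add: mat_trace_def T_def mult.commute) (rule sum.swap)
  also have "\<dots> = (\<Sum>x\<in>carrier G. \<rho> (inv x \<otimes> x) $$ (j, i))"
    by (intro sum.cong refl)
      (use assms in \<open>simp only: unitary_rep_mult[OF rep] inv_closed mat_mult_index[OF c1 c1]\<close>)
  also have "\<dots> = (if i = j then of_nat (card (carrier G)) else 0)"
    using assms by (simp add: unitary_rep_one[OF rep])
  finally have "c = (if i = j then of_nat (card (carrier G)) / of_nat n else 0)"
    using n by (auto simp: field_simps)
  moreover have "T $$ (a, b) = (if a = b then c else 0)" unfolding c using assms by simp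
  ultimately show ?thesis using assms by (auto simp: T_def)
qed

end

section \<open>Complete reducibility and the expansion of the unit\<close>

context finite_group
begin

text \<open>The operator \<open>1/|G| \<Sum>\<^sub>x g(x) \<rho>(x\<^sup>-\<^sup>1)\<close> by which a function \<open>g\<close> acts on a representation \<open>\<rho>\<close> of degree \<open>n\<close>.
  The inverse makes this a Fourier coefficient of \<open>g\<close> at \<open>\<rho>\<close>.\<close>

definition group_algebra_op :: "('a \<Rightarrow> complex) \<Rightarrow> nat \<Rightarrow> ('a \<Rightarrow> complex mat) \<Rightarrow> complex mat" where
  "group_algebra_op g n \<rho> = mat n n (\<lambda>(i, j).
     1 / of_nat (card (carrier G)) * (\<Sum>x\<in>carrier G. g x * \<rho> (inv x) $$ (i, j)))"

lemma group_algebra_op_carrier [simp]: "group_algebra_op g n \<rho> \<in> carrier_mat n n"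
  by (simp add: group_algebra_op_def)

lemma group_algebra_op_intertwines:
  assumes rep: "unitary_rep G n \<rho>" "unitary_rep G m \<sigma>" and T: "T \<in> carrier_mat m n"
    and comm: "\<And>x. x \<in> carrier G \<Longrightarrow> T * \<rho> x = \<sigma> x * T"
  shows "T * group_algebra_op g n \<rho> = group_algebra_op g m \<sigma> * T"
proof (rule eq_matI)
  note c1 = unitary_rep_carrier[OF rep(1)] and c2 = unitary_rep_carrier[OF rep(2)]
  fix i j assume "i < dim_row (group_algebra_op g m \<sigma> * T)" "j < dim_col (group_algebra_op g m \<sigma> * T)"
  then have ij: "i < m" "j < n" using T by (auto simp: group_algebra_op_def)
  define N where "N = (1 / of_nat (card (carrier G)) :: complex)"
  have "(T * group_algebra_op g n \<rho>) $$ (i, j)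
      = (\<Sum>k<n. T $$ (i, k) * (N * (\<Sum>x\<in>carrier G. g x * \<rho> (inv x) $$ (k, j))))"
    using mat_mult_index[OF T group_algebra_op_carrier ij] ij by (simp add: group_algebra_op_def N_def)
  also have "\<dots> = (\<Sum>k<n. \<Sum>x\<in>carrier G. N * g x * (T $$ (i, k) * \<rho> (inv x) $$ (k, j)))"
    by (simp add: sum_distrib_left mult_ac)
  also have "\<dots> = (\<Sum>x\<in>carrier G. N * g x * (\<Sum>k<n. T $$ (i, k) * \<rho> (inv x) $$ (k, j)))"
    by (subst sum.swap) (simp add: sum_distrib_left)
  also have "\<dots> = (\<Sum>x\<in>carrier G. N * g x * (\<Sum>k<m. \<sigma> (inv x) $$ (i, k) * T $$ (k, j)))"
  proof (rule sum.cong)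
    fix x assume "x \<in> carrier G"
    then have x: "inv x \<in> carrier G" by simp
    show "N * g x * (\<Sum>k<n. T $$ (i, k) * \<rho> (inv x) $$ (k, j))
        = N * g x * (\<Sum>k<m. \<sigma> (inv x) $$ (i, k) * T $$ (k, j))"
      using comm[OF x] mat_mult_index[OF T c1[OF x] ij] mat_mult_index[OF c2[OF x] T ij] by simp
  qed simp
  also have "\<dots> = (\<Sum>k<m. \<Sum>x\<in>carrier G. N * g x * (\<sigma> (inv x) $$ (i, k) * T $$ (k, j)))"
    by (subst sum.swap) (simp add: sum_distrib_left)
  also have "\<dots> = (\<Sum>k<m. (N * (\<Sum>x\<in>carrier G. g x * \<sigma> (inv x) $$ (i, k))) * T $$ (k, j))"
    by (simp add: sum_distrib_left sum_distrib_right mult_ac)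
  also have "\<dots> = (group_algebra_op g m \<sigma> * T) $$ (i, j)"
    using mat_mult_index[OF group_algebra_op_carrier T ij, of g \<sigma>] ij by (simp add: group_algebra_op_def N_def)
  finally show "(T * group_algebra_op g n \<rho>) $$ (i, j) = (group_algebra_op g m \<sigma> * T) $$ (i, j)" .
qed (use T in \<open>auto simp: group_algebra_op_def\<close>)

text \<open>The restriction of \<open>\<rho>\<close> to an invariant subspace, written in the orthonormal basis given by the
  columns of \<open>V\<close>; the last hypothesis says that the range of \<open>V\<close> is invariant.\<close>

lemma unitary_rep_restrict:
  assumes rep: "unitary_rep G n \<rho>" and V: "V \<in> carrier_mat n m" and iso: "mat_adjoint V * V = 1\<^sub>m m"
    and inv: "\<And>x. x \<in> carrier G \<Longrightarrow> V * (mat_adjoint V * (\<rho> x * V)) = \<rho> x * V"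
  shows "unitary_rep G m (\<lambda>x. mat_adjoint V * (\<rho> x * V))"
proof (rule unitary_repI)
  note c = unitary_rep_carrier[OF rep]
  have aV: "mat_adjoint V \<in> carrier_mat m n" using V by (rule mat_adjoint_carrier)
  show "mat_adjoint V * (\<rho> x * V) \<in> carrier_mat m m" if "x \<in> carrier G" for x
    using aV c[OF that] V by auto
  show "mat_adjoint V * (\<rho> \<one> * V) = 1\<^sub>m m"
    unfolding unitary_rep_one[OF rep] left_mult_one_mat[OF V] by (rule iso)
  fix x assume x: "x \<in> carrier G"
  have rV: "\<rho> x * V \<in> carrier_mat n m" using c[OF x] V by (rule mult_carrier_mat)
  show "mat_adjoint (mat_adjoint V * (\<rho> x * V)) = mat_adjoint V * (\<rho> (inv x) * V)"
    unfolding mat_adjoint_mult[OF aV rV] mat_adjoint_mult[OF c[OF x] V] mat_adjoint_adjoint[OF V]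
      unitary_rep_adjoint[OF rep x]
    using assoc_mult_mat[OF aV c V] x by simp
  fix y assume y: "y \<in> carrier G"
  have rVy: "\<rho> y * V \<in> carrier_mat n m" using c[OF y] V by (rule mult_carrier_mat)
  have aVy: "mat_adjoint V * (\<rho> y * V) \<in> carrier_mat m m" using aV rVy by (rule mult_carrier_mat)
  have "mat_adjoint V * (\<rho> (x \<otimes> y) * V) = mat_adjoint V * (\<rho> x * (\<rho> y * V))"
    using unitary_rep_mult[OF rep x y] assoc_mult_mat[OF c[OF x] c[OF y] V] by simp
  also have "\<rho> y * V = V * (mat_adjoint V * (\<rho> y * V))" using inv[OF y] ..
  also have "\<rho> x * (V * (mat_adjoint V * (\<rho> y * V))) = (\<rho> x * V) * (mat_adjoint V * (\<rho> y * V))"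
    using assoc_mult_mat[OF c[OF x] V aVy] by simp
  also have "mat_adjoint V * \<dots> = (mat_adjoint V * (\<rho> x * V)) * (mat_adjoint V * (\<rho> y * V))"
    using assoc_mult_mat[OF aV rV aVy] by simp
  finally show "mat_adjoint V * (\<rho> (x \<otimes> y) * V)
      = (mat_adjoint V * (\<rho> x * V)) * (mat_adjoint V * (\<rho> y * V))" .
qed

text \<open>Complete reducibility, in the only form needed: a function that acts as the identity on every
  irreducible representation acts as the identity on every unitary representation. By induction on
  the degree, it acts as the identity on an invariant subspace and on its orthogonal complement.\<close>

lemma group_algebra_op_one_if_irreducible:
  assumes irr: "\<And>n \<rho>. irreducible_unitary_rep G n \<rho> \<Longrightarrow> group_algebra_op g n \<rho> = 1\<^sub>m n"
  shows "unitary_rep G n \<rho> \<Longrightarrow> group_algebra_op g n \<rho> = 1\<^sub>m n"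
proof (induction n arbitrary: \<rho> rule: less_induct)
  case (less n)
  note rep = less.prems
  note c = unitary_rep_carrier[OF rep]
  show ?case
  proof (cases "n = 0 \<or> irreducible_unitary_rep G n \<rho>")
    case True
    then show ?thesis
    proof
      assume "n = 0"
      then show ?thesis by (intro eq_matI) (auto simp: group_algebra_op_def)
    qed (rule irr)
  next
    case False
    then obtain W where W: "linear_subspace n W" and inv: "\<And>x v. x \<in> carrier G \<Longrightarrow> v \<in> W \<Longrightarrow> \<rho> x *\<^sub>v v \<in> W"
      and "W \<noteq> {0\<^sub>v n}" "W \<noteq> carrier_vec n"
      using not_irreducible_unitary_repE[OF rep] by blast
    then obtain m V m' V' where
      V: "V \<in> carrier_mat n m" and iso: "mat_adjoint V * V = 1\<^sub>m m" and m: "m < n" and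
      V': "V' \<in> carrier_mat n m'" and iso': "mat_adjoint V' * V' = 1\<^sub>m m'" and m': "m' < n" and
      sum1: "V * mat_adjoint V + V' * mat_adjoint V' = 1\<^sub>m n" and VV': "mat_adjoint V * V' = 0\<^sub>m m m'" and
      into: "\<And>c. c \<in> carrier_vec m \<Longrightarrow> V *\<^sub>v c \<in> W" and
      onto: "\<And>w. w \<in> W \<Longrightarrow> V *\<^sub>v (mat_adjoint V *\<^sub>v w) = w"
      using obtain_orthogonal_splitting[OF W] by metis
    have aV: "mat_adjoint V \<in> carrier_mat m n" using V by (rule mat_adjoint_carrier)
    have aV': "mat_adjoint V' \<in> carrier_mat m' n" using V' by (rule mat_adjoint_carrier)
    have inv1: "V * (mat_adjoint V * (\<rho> x * V)) = \<rho> x * V" if x: "x \<in> carrier G" for x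
    proof (rule mat_eq_if_mult_vec_eq[of _ n m])
      have rV: "\<rho> x * V \<in> carrier_mat n m" using c[OF x] V by (rule mult_carrier_mat)
      then show "\<rho> x * V \<in> carrier_mat n m" "V * (mat_adjoint V * (\<rho> x * V)) \<in> carrier_mat n m"
        using V aV by auto
      fix v :: "complex vec" assume v: "v \<in> carrier_vec m"
      have "(V * (mat_adjoint V * (\<rho> x * V))) *\<^sub>v v = V *\<^sub>v (mat_adjoint V *\<^sub>v ((\<rho> x * V) *\<^sub>v v))"
        using assoc_mult_mat_vec[OF V mult_carrier_mat[OF aV rV] v] assoc_mult_mat_vec[OF aV rV v] by simp
      also have "\<dots> = (\<rho> x * V) *\<^sub>v v"
        by (rule onto) (use inv[OF x into[OF v]] assoc_mult_mat_vec[OF c[OF x] V v] in simp)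
      finally show "(V * (mat_adjoint V * (\<rho> x * V))) *\<^sub>v v = (\<rho> x * V) *\<^sub>v v" .
    qed
    \<comment> \<open>The complement is invariant because the adjoint of \<open>\<rho>(x)\<close> is \<open>\<rho>(x\<^sup>-\<^sup>1)\<close>, which preserves \<open>W\<close>.\<close>
    have inv2: "V' * (mat_adjoint V' * (\<rho> x * V')) = \<rho> x * V'" if x: "x \<in> carrier G" for x
    proof -
      have x': "inv x \<in> carrier G" using x by simp
      have rV: "\<rho> (inv x) * V \<in> carrier_mat n m" using c[OF x'] V by (rule mult_carrier_mat)
      have rV': "\<rho> x * V' \<in> carrier_mat n m'" using c[OF x] V' by (rule mult_carrier_mat)
      have "mat_adjoint (V * (mat_adjoint V * (\<rho> (inv x) * V))) = mat_adjoint (\<rho> (inv x) * V)"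
        using inv1[OF x'] by simp
      then have "((mat_adjoint V * \<rho> x) * V) * mat_adjoint V = mat_adjoint V * \<rho> x"
        unfolding mat_adjoint_mult[OF V mult_carrier_mat[OF aV rV]] mat_adjoint_mult[OF aV rV]
          mat_adjoint_mult[OF c[OF x'] V] mat_adjoint_adjoint[OF V]
        using unitary_rep_adjoint[OF rep x'] x by simp
      then have "mat_adjoint V * (\<rho> x * V') = (((mat_adjoint V * \<rho> x) * V) * mat_adjoint V) * V'"
        using assoc_mult_mat[OF aV c[OF x] V'] by simp
      also have "\<dots> = ((mat_adjoint V * \<rho> x) * V) * (mat_adjoint V * V')"
        by (rule assoc_mult_mat[OF mult_carrier_mat[OF mult_carrier_mat[OF aV c[OF x]] V] aV V'])
      also have "\<dots> = 0\<^sub>m m m'"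
        unfolding VV' by (rule right_mult_zero_mat[OF mult_carrier_mat[OF mult_carrier_mat[OF aV c[OF x]] V]])
      finally have z: "mat_adjoint V * (\<rho> x * V') = 0\<^sub>m m m'" .
      have "\<rho> x * V' = (V * mat_adjoint V + V' * mat_adjoint V') * (\<rho> x * V')"
        unfolding sum1 left_mult_one_mat[OF rV'] ..
      also have "\<dots> = (V * mat_adjoint V) * (\<rho> x * V') + (V' * mat_adjoint V') * (\<rho> x * V')"
        by (rule add_mult_distrib_mat[OF mult_carrier_mat[OF V aV] mult_carrier_mat[OF V' aV'] rV'])
      also have "\<dots> = V * 0\<^sub>m m m' + V' * (mat_adjoint V' * (\<rho> x * V'))"
        unfolding assoc_mult_mat[OF V aV rV'] assoc_mult_mat[OF V' aV' rV'] z ..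
      also have "\<dots> = V' * (mat_adjoint V' * (\<rho> x * V'))"
        unfolding right_mult_zero_mat[OF V]
        by (rule left_add_zero_mat[OF mult_carrier_mat[OF V' mult_carrier_mat[OF aV' rV']]])
      finally show ?thesis ..
    qed
    let ?P = "group_algebra_op g n \<rho>"
    have P: "?P \<in> carrier_mat n n" by simp
    have PV: "?P * X = X"
      if X: "X \<in> carrier_mat n l" and "l < n" and isoX: "mat_adjoint X * X = 1\<^sub>m l"
        and invX: "\<And>x. x \<in> carrier G \<Longrightarrow> X * (mat_adjoint X * (\<rho> x * X)) = \<rho> x * X" for X l
    proof -
      have rX: "unitary_rep G l (\<lambda>x. mat_adjoint X * (\<rho> x * X))"
        by (rule unitary_rep_restrict[OF rep X isoX invX])
      have "?P * X = X * group_algebra_op g l (\<lambda>x. mat_adjoint X * (\<rho> x * X))"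
        by (rule group_algebra_op_intertwines[OF rX rep X invX, symmetric])
      also have "\<dots> = X" using less.IH[OF \<open>l < n\<close> rX] X by simp
      finally show ?thesis .
    qed
    have PV1: "?P * V = V" by (rule PV[OF V m iso inv1])
    have PV2: "?P * V' = V'" by (rule PV[OF V' m' iso' inv2])
    have "?P = ?P * (V * mat_adjoint V + V' * mat_adjoint V')" unfolding sum1 right_mult_one_mat[OF P] ..
    also have "\<dots> = ?P * (V * mat_adjoint V) + ?P * (V' * mat_adjoint V')"
      by (rule mult_add_distrib_mat[OF P mult_carrier_mat[OF V aV] mult_carrier_mat[OF V' aV']])
    also have "\<dots> = V * mat_adjoint V + V' * mat_adjoint V'"
      unfolding assoc_mult_mat[OF P V aV, symmetric] assoc_mult_mat[OF P V' aV', symmetric] PV1 PV2 ..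
    finally show ?thesis unfolding sum1 .
  qed
qed

text \<open>In the left regular representation the values of \<open>g\<close> can be read off from matrix entries, so the
  only function acting as the identity on all representations is the unit \<open>|G| \<delta>\<^sub>1\<close> of convolution.\<close>

lemma delta_if_group_algebra_op_one:
  assumes one: "\<And>n \<rho>. unitary_rep G n \<rho> \<Longrightarrow> group_algebra_op g n \<rho> = 1\<^sub>m n"
    and z: "z \<in> carrier G"
  shows "g z = (if z = \<one> then of_nat (card (carrier G)) else 0)"
proof -
  define N where "N = card (carrier G)"
  obtain h where h: "bij_betw h {..<N} (carrier G)"
    using ex_bij_betw_nat_finite[OF finite_carrier] unfolding N_def atLeast0LessThan by blast
  have hc: "h i \<in> carrier G" if "i < N" for i using h that by (auto simp: bij_betw_def)
  have hinj: "h i = h j \<longleftrightarrow> i = j" if "i < N" "j < N" for i j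
    using h that by (auto simp: bij_betw_def inj_on_def)
  have hsurj: "\<exists>i<N. h i = x" if "x \<in> carrier G" for x using h that unfolding bij_betw_def by (metis imageE lessThan_iff)
  \<comment> \<open>the left regular representation, as permutation matrices for the enumeration \<open>h\<close> of the group\<close>
  define L where "L x = mat N N (\<lambda>(i, j). if x \<otimes> h j = h i then 1 else 0 :: complex)" for x
  have Lc: "L x \<in> carrier_mat N N" for x by (simp add: L_def)
  have Ldim [simp]: "dim_row (L x) = N" "dim_col (L x) = N" for x by (simp_all add: L_def)
  have "unitary_rep G N L"
  proof (rule unitary_repI)
    show "L \<one> = 1\<^sub>m N" by (rule eq_matI) (auto simp: L_def hc hinj)
    fix x assume x: "x \<in> carrier G"
    show "mat_adjoint (L x) = L (inv x)"
    proof (rule eq_matI)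
      fix i j assume "i < dim_row (L (inv x))" "j < dim_col (L (inv x))"
      then have ij: "i < N" "j < N" by auto
      have "x \<otimes> h i = h j \<longleftrightarrow> inv x \<otimes> h j = h i"
        using x hc[OF ij(1)] hc[OF ij(2)] by (metis inv_closed inv_solve_left inv_inv m_closed)
      then show "mat_adjoint (L x) $$ (i, j) = L (inv x) $$ (i, j)"
        using ij mat_adjoint_index[OF Lc ij] by (simp add: L_def)
    qed auto
    fix y assume y: "y \<in> carrier G"
    show "L (x \<otimes> y) = L x * L y"
    proof (rule eq_matI)
      fix i j assume "i < dim_row (L x * L y)" "j < dim_col (L x * L y)"
      then have ij: "i < N" "j < N" by auto
      obtain l where l: "l < N" "h l = y \<otimes> h j" using hsurj[of "y \<otimes> h j"] y hc[OF ij(2)] by auto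
      have "(L x * L y) $$ (i, j) = (\<Sum>k<N. if k = l then L x $$ (i, k) else 0)"
        unfolding mat_mult_index[OF Lc Lc ij]
        by (rule sum.cong) (use ij l hinj in \<open>auto simp: L_def simp flip: l(2)\<close>)
      also have "\<dots> = L (x \<otimes> y) $$ (i, j)"
        using ij l x y hc[OF ij(2)] by (simp add: L_def m_assoc)
      finally show "L (x \<otimes> y) $$ (i, j) = (L x * L y) $$ (i, j)" ..
    qed auto
  qed (use Lc in auto)
  then have P: "group_algebra_op g N L = 1\<^sub>m N" by (rule one)
  obtain i where i: "i < N" "h i = \<one>" using hsurj[OF one_closed] by blast
  obtain j where j: "j < N" "h j = z" using hsurj[OF z] by blast
  have iff: "inv x \<otimes> z = \<one> \<longleftrightarrow> x = z" if "x \<in> carrier G" for x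
    using that z by (metis inv_closed inv_equality inv_inv l_inv)
  have "1\<^sub>m N $$ (i, j) = 1 / of_nat N * (\<Sum>x\<in>carrier G. g x * L (inv x) $$ (i, j))"
    unfolding P[symmetric] using i j by (simp add: group_algebra_op_def N_def)
  also have "(\<Sum>x\<in>carrier G. g x * L (inv x) $$ (i, j)) = (\<Sum>x\<in>carrier G. if x = z then g x else 0)"
    by (rule sum.cong) (use i j iff in \<open>auto simp: L_def\<close>)
  also have "\<dots> = g z" using z finite_carrier by simp
  finally have "g z = of_nat N * (if i = j then 1 else 0)"
    using i j card_carrier_pos by (simp add: N_def field_simps)
  moreover have "i = j \<longleftrightarrow> z = \<one>" using hinj[OF i(1) j(1)] i j by auto
  ultimately show ?thesis by (simp add: N_def)
qed

end

section \<open>Convolution on a finite group\<close>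

context finite_group
begin

lemma Re_L2_inner_self:
  "Re (L2_inner G f f) = 1 / real (card (carrier G)) * (\<Sum>x\<in>carrier G. (cmod (f x))\<^sup>2)"
proof -
  have "L2_inner G f f = complex_of_real (1 / real (card (carrier G)) * (\<Sum>x\<in>carrier G. (cmod (f x))\<^sup>2))"
    by (simp add: L2_inner_def complex_norm_square[symmetric])
  then show ?thesis by simp
qed

lemma L2_norm_sq: "(L2_norm G f)\<^sup>2 = 1 / real (card (carrier G)) * (\<Sum>x\<in>carrier G. (cmod (f x))\<^sup>2)"
  unfolding L2_norm_def Re_L2_inner_self by (simp add: sum_nonneg)

lemma L2_inner_self: "L2_inner G f f = complex_of_real ((L2_norm G f)\<^sup>2)"
  unfolding L2_norm_sq by (simp add: L2_inner_def complex_norm_square[symmetric])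

lemma L2_norm_nonneg: "L2_norm G f \<ge> 0"
  unfolding L2_norm_def Re_L2_inner_self by (simp add: sum_nonneg)

lemma L2_norm_cong: "(\<And>x. x \<in> carrier G \<Longrightarrow> f x = g x) \<Longrightarrow> L2_norm G f = L2_norm G g"
  unfolding L2_norm_def L2_inner_def by simp

lemma L2_inner_cong:
  "(\<And>x. x \<in> carrier G \<Longrightarrow> f x = f' x) \<Longrightarrow> (\<And>x. x \<in> carrier G \<Longrightarrow> g x = g' x) \<Longrightarrow>
    L2_inner G f g = L2_inner G f' g'"
  unfolding L2_inner_def by simp

lemma L2_norm_cmod: "L2_norm G (\<lambda>x. complex_of_real (cmod (f x))) = L2_norm G f"
proof -
  have "(L2_norm G (\<lambda>x. complex_of_real (cmod (f x))))\<^sup>2 = (L2_norm G f)\<^sup>2"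
    unfolding L2_norm_sq by simp
  then show ?thesis using L2_norm_nonneg by (simp add: power2_eq_iff_nonneg)
qed

lemma convolution_cong:
  assumes "\<And>x. x \<in> carrier G \<Longrightarrow> f x = f' x" "\<And>x. x \<in> carrier G \<Longrightarrow> g x = g' x" "z \<in> carrier G"
  shows "convolution G f g z = convolution G f' g' z"
  unfolding convolution_def using assms by simp

lemma convolution_assoc:
  assumes z: "z \<in> carrier G"
  shows "convolution G (convolution G f g) h z = convolution G f (convolution G g h) z"
proof -
  define N where "N = (1 / of_nat (card (carrier G)) :: complex)"
  have "convolution G (convolution G f g) h z
      = N * (\<Sum>y\<in>carrier G. \<Sum>w\<in>carrier G. N * f w * (g (inv w \<otimes> y) * h (inv y \<otimes> z)))"
    unfolding convolution_def N_def by (simp add: sum_distrib_left sum_distrib_right mult_ac)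
  also have "\<dots> = N * (\<Sum>w\<in>carrier G. N * f w * (\<Sum>y\<in>carrier G. g (inv w \<otimes> y) * h (inv y \<otimes> z)))"
    by (subst sum.swap) (simp add: sum_distrib_left)
  also have "\<dots> = N * (\<Sum>w\<in>carrier G. N * f w * (\<Sum>u\<in>carrier G. g u * h (inv u \<otimes> (inv w \<otimes> z))))"
  proof -
    have "(\<Sum>y\<in>carrier G. g (inv w \<otimes> y) * h (inv y \<otimes> z))
        = (\<Sum>u\<in>carrier G. g u * h (inv u \<otimes> (inv w \<otimes> z)))" if w: "w \<in> carrier G" for w
    proof -
      have "(\<Sum>y\<in>carrier G. g (inv w \<otimes> y) * h (inv y \<otimes> z))
          = (\<Sum>y\<in>carrier G. g (inv w \<otimes> y) * h (inv (inv w \<otimes> y) \<otimes> (inv w \<otimes> z)))"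
      proof (rule sum.cong)
        fix y assume y: "y \<in> carrier G"
        have "inv (inv w \<otimes> y) \<otimes> (inv w \<otimes> z) = inv y \<otimes> (w \<otimes> (inv w \<otimes> z))"
          using w y z by (simp add: inv_mult_group m_assoc)
        also have "\<dots> = inv y \<otimes> z" using w z by (simp add: m_assoc[symmetric])
        finally show "g (inv w \<otimes> y) * h (inv y \<otimes> z)
            = g (inv w \<otimes> y) * h (inv (inv w \<otimes> y) \<otimes> (inv w \<otimes> z))" by simp
      qed simp
      also have "\<dots> = (\<Sum>u\<in>carrier G. g u * h (inv u \<otimes> (inv w \<otimes> z)))"
        by (rule sum_left_translate[where h = "\<lambda>u. g u * h (inv u \<otimes> (inv w \<otimes> z))"]) (use w in simp)
      finally show ?thesis .
    qed
    then show ?thesis by simp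
  qed
  also have "\<dots> = convolution G f (convolution G g h) z"
    unfolding convolution_def N_def by (simp add: sum_distrib_left mult_ac)
  finally show ?thesis .
qed

text \<open>Convolution by a function with \<open>a(x\<^sup>-\<^sup>1) = cnj (a(x))\<close> is self-adjoint.\<close>

lemma L2_inner_convolution_left:
  assumes "\<And>x. x \<in> carrier G \<Longrightarrow> a (inv x) = cnj (a x)"
  shows "L2_inner G (convolution G a f) g = L2_inner G f (convolution G a g)"
proof -
  define N where "N = (1 / of_nat (card (carrier G)) :: complex)"
  have cN: "cnj N = N" by (simp add: N_def)
  have "L2_inner G (convolution G a f) g
      = N * (\<Sum>x\<in>carrier G. \<Sum>y\<in>carrier G. N * a y * (f (inv y \<otimes> x) * cnj (g x)))"
    unfolding L2_inner_def convolution_def N_def by (simp add: sum_distrib_left sum_distrib_right mult_ac)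
  also have "\<dots> = N * (\<Sum>y\<in>carrier G. N * a y * (\<Sum>x\<in>carrier G. f (inv y \<otimes> x) * cnj (g x)))"
    by (subst sum.swap) (simp add: sum_distrib_left)
  also have "\<dots> = N * (\<Sum>y\<in>carrier G. N * a y * (\<Sum>x\<in>carrier G. f x * cnj (g (y \<otimes> x))))"
  proof -
    have "(\<Sum>x\<in>carrier G. f (inv y \<otimes> x) * cnj (g x)) = (\<Sum>x\<in>carrier G. f x * cnj (g (y \<otimes> x)))"
      if y: "y \<in> carrier G" for y
    proof -
      have "(\<Sum>x\<in>carrier G. f (inv y \<otimes> x) * cnj (g x))
          = (\<Sum>x\<in>carrier G. f (inv y \<otimes> (y \<otimes> x)) * cnj (g (y \<otimes> x)))"
        by (rule sum_left_translate[OF y, symmetric])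
      also have "\<dots> = (\<Sum>x\<in>carrier G. f x * cnj (g (y \<otimes> x)))"
        using y by (intro sum.cong) (auto simp: m_assoc[symmetric])
      finally show ?thesis .
    qed
    then show ?thesis by simp
  qed
  also have "\<dots> = N * (\<Sum>y\<in>carrier G. N * a (inv y) * (\<Sum>x\<in>carrier G. f x * cnj (g (inv y \<otimes> x))))"
    by (subst sum_inv[symmetric]) simp
  also have "\<dots> = N * (\<Sum>y\<in>carrier G. \<Sum>x\<in>carrier G. N * cnj (a y) * (f x * cnj (g (inv y \<otimes> x))))"
    using assms by (simp add: sum_distrib_left)
  also have "\<dots> = L2_inner G f (convolution G a g)"
    unfolding L2_inner_def convolution_def
    by (subst sum.swap) (simp add: N_def sum_distrib_left sum_distrib_right mult_ac)
  finally show ?thesis .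
qed

lemma L2_inner_sum_sum:
  "L2_inner G (\<lambda>x. \<Sum>r\<in>R. c r * F r x) (\<lambda>x. \<Sum>s\<in>R. c s * F s x)
    = (\<Sum>r\<in>R. \<Sum>s\<in>R. c r * cnj (c s) * L2_inner G (F r) (F s))"
proof -
  define N where "N = (1 / of_nat (card (carrier G)) :: complex)"
  have "L2_inner G (\<lambda>x. \<Sum>r\<in>R. c r * F r x) (\<lambda>x. \<Sum>s\<in>R. c s * F s x)
    = (\<Sum>x\<in>carrier G. \<Sum>r\<in>R. \<Sum>s\<in>R. c r * cnj (c s) * (N * (F r x * cnj (F s x))))"
    unfolding L2_inner_def N_def
    by (simp add: sum_distrib_left sum_distrib_right mult_ac) (rule sum.cong[OF refl], rule sum.swap)
  also have "\<dots> = (\<Sum>r\<in>R. \<Sum>s\<in>R. \<Sum>x\<in>carrier G. c r * cnj (c s) * (N * (F r x * cnj (F s x))))"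
    by (subst sum.swap) (rule sum.cong[OF refl], rule sum.swap)
  also have "\<dots> = (\<Sum>r\<in>R. \<Sum>s\<in>R. c r * cnj (c s) * L2_inner G (F r) (F s))"
    unfolding L2_inner_def N_def by (simp add: sum_distrib_left)
  finally show ?thesis .
qed

lemma convolution_sum_left:
  "convolution G (\<lambda>x. \<Sum>r\<in>R. c r * F r x) f z = (\<Sum>r\<in>R. c r * convolution G (F r) f z)"
  unfolding convolution_def
  by (simp add: sum_distrib_left sum_distrib_right mult_ac) (rule sum.swap)

end

section \<open>The Plancherel formula\<close>

text \<open>A finite group with a complete system of inequivalent irreducible unitary representations.\<close>

locale finite_group_irreps = finite_group +
  fixes k :: nat and d :: "nat \<Rightarrow> nat" and \<pi> :: "nat \<Rightarrow> 'a \<Rightarrow> complex mat"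
  assumes complete: "complete_irreps G k d \<pi>"
begin

lemma irr: "r \<in> {1..k} \<Longrightarrow> irreducible_unitary_rep G (d r) (\<pi> r)"
  using complete unfolding complete_irreps_def by blast

lemma rep: "r \<in> {1..k} \<Longrightarrow> unitary_rep G (d r) (\<pi> r)"
  using irr irreducible_unitary_repD(1) by blast

lemma inequivalent: "r \<in> {1..k} \<Longrightarrow> s \<in> {1..k} \<Longrightarrow> r \<noteq> s \<Longrightarrow> \<not> equivalent_reps G (d r) (\<pi> r) (d s) (\<pi> s)"
  using complete unfolding complete_irreps_def by blast

text \<open>The function \<open>d\<^sub>r \<chi>\<^sup>r\<close>; convolution by it is the orthogonal projection onto the isotypic component
  of \<open>\<pi> r\<close> in the space of functions on the group.\<close>

definition isotypic :: "nat \<Rightarrow> 'a \<Rightarrow> complex" where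
  "isotypic r x = of_nat (d r) * rep_character (\<pi> r) x"

lemma isotypic_entries:
  assumes "r \<in> {1..k}" "x \<in> carrier G"
  shows "isotypic r x = of_nat (d r) * (\<Sum>a<d r. \<pi> r x $$ (a, a))"
  using mat_trace_carrier[OF unitary_rep_carrier[OF rep]] assms by (simp add: isotypic_def rep_character_def)

lemma isotypic_inv:
  assumes r: "r \<in> {1..k}" and x: "x \<in> carrier G"
  shows "isotypic r (inv x) = cnj (isotypic r x)"
proof -
  have "(\<Sum>a<d r. \<pi> r (inv x) $$ (a, a)) = (\<Sum>a<d r. cnj (\<pi> r x $$ (a, a)))"
    using mat_adjoint_index[OF unitary_rep_carrier[OF rep[OF r] x]] unitary_rep_adjoint[OF rep[OF r] x]
    by (intro sum.cong) auto
  then show ?thesis using isotypic_entries[OF r x] isotypic_entries[OF r, of "inv x"] x by simp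
qed

text \<open>Schur orthogonality says that \<open>isotypic r\<close> acts as the identity on \<open>\<pi> r\<close> and as zero on the other
  irreducible representations.\<close>

lemma isotypic_acts:
  assumes r: "r \<in> {1..k}" and s: "s \<in> {1..k}" and ij: "i < d s" "j < d s"
  shows "1 / of_nat (card (carrier G)) * (\<Sum>x\<in>carrier G. isotypic r x * \<pi> s (inv x) $$ (i, j))
    = (if r = s \<and> i = j then 1 else 0)"
proof -
  have "(\<Sum>x\<in>carrier G. isotypic r x * \<pi> s (inv x) $$ (i, j))
      = (\<Sum>x\<in>carrier G. \<Sum>a<d r. of_nat (d r) * (\<pi> r x $$ (a, a) * \<pi> s (inv x) $$ (i, j)))"
    by (rule sum.cong) (simp_all add: isotypic_entries[OF r] sum_distrib_left sum_distrib_right mult_ac)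
  also have "\<dots> = of_nat (d r) * (\<Sum>a<d r. \<Sum>x\<in>carrier G. \<pi> r x $$ (a, a) * \<pi> s (inv x) $$ (i, j))"
    by (subst sum.swap) (simp add: sum_distrib_left)
  also have "(\<Sum>a<d r. \<Sum>x\<in>carrier G. \<pi> r x $$ (a, a) * \<pi> s (inv x) $$ (i, j))
      = (\<Sum>a<d r. if a = i then if r = s \<and> i = j then of_nat (card (carrier G)) / of_nat (d r) else 0 else 0)"
  proof (rule sum.cong)
    fix a assume "a \<in> {..<d r}"
    then have a: "a < d r" by simp
    show "(\<Sum>x\<in>carrier G. \<pi> r x $$ (a, a) * \<pi> s (inv x) $$ (i, j))
      = (if a = i then if r = s \<and> i = j then of_nat (card (carrier G)) / of_nat (d r) else 0 else 0)"
    proof (cases "r = s")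
      case True
      then show ?thesis using schur_orthogonality_same[OF irr[OF s] _ ij(1) _ ij(2), of a a] a by auto
    next
      case False
      then show ?thesis
        using schur_orthogonality_inequivalent[OF irr[OF s] irr[OF r] inequivalent[OF s r] a ij(1) a ij(2)] by auto
    qed
  qed simp
  also have "\<dots> = (if r = s \<and> i = j then of_nat (card (carrier G)) / of_nat (d r) else 0)"
    using ij by auto
  finally show ?thesis
    using irreducible_unitary_repD(2)[OF irr[OF r]] card_carrier_pos by auto
qed

text \<open>The functions \<open>isotypic r\<close> are orthogonal idempotents.\<close>

lemma isotypic_convolution:
  assumes r: "r \<in> {1..k}" and s: "s \<in> {1..k}" and z: "z \<in> carrier G"
  shows "convolution G (isotypic r) (isotypic s) z = (if r = s then isotypic s z else 0)"
proof -
  define N where "N = (1 / of_nat (card (carrier G)) :: complex)"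
  note c = unitary_rep_carrier[OF rep[OF s]]
  have "convolution G (isotypic r) (isotypic s) z
      = N * (\<Sum>y\<in>carrier G. isotypic r y *
          (of_nat (d s) * (\<Sum>i<d s. \<Sum>j<d s. \<pi> s (inv y) $$ (i, j) * \<pi> s z $$ (j, i))))"
    unfolding convolution_def N_def[symmetric]
  proof (intro arg_cong[where f = "\<lambda>t. N * t"] sum.cong refl)
    fix y assume y: "y \<in> carrier G"
    have "isotypic s (inv y \<otimes> z) = of_nat (d s) * mat_trace (\<pi> s (inv y) * \<pi> s z)"
      using unitary_rep_mult[OF rep[OF s], of "inv y" z] y z by (simp add: isotypic_def rep_character_def)
    also have "mat_trace (\<pi> s (inv y) * \<pi> s z) = (\<Sum>i<d s. \<Sum>j<d s. \<pi> s (inv y) $$ (i, j) * \<pi> s z $$ (j, i))"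
      by (rule mat_trace_mult) (use c y z in auto)
    finally show "isotypic r y * isotypic s (inv y \<otimes> z)
        = isotypic r y * (of_nat (d s) * (\<Sum>i<d s. \<Sum>j<d s. \<pi> s (inv y) $$ (i, j) * \<pi> s z $$ (j, i)))"
      by simp
  qed
  also have "\<dots> = (\<Sum>y\<in>carrier G. \<Sum>i<d s. \<Sum>j<d s.
      of_nat (d s) * (N * (isotypic r y * \<pi> s (inv y) $$ (i, j))) * \<pi> s z $$ (j, i))"
    by (simp add: sum_distrib_left mult_ac)
  also have "\<dots> = (\<Sum>i<d s. \<Sum>j<d s. \<Sum>y\<in>carrier G.
      of_nat (d s) * (N * (isotypic r y * \<pi> s (inv y) $$ (i, j))) * \<pi> s z $$ (j, i))"
    by (subst sum.swap) (rule sum.cong[OF refl], rule sum.swap)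
  also have "\<dots> = (\<Sum>i<d s. \<Sum>j<d s.
      of_nat (d s) * (N * (\<Sum>y\<in>carrier G. isotypic r y * \<pi> s (inv y) $$ (i, j))) * \<pi> s z $$ (j, i))"
    by (simp add: sum_distrib_left sum_distrib_right)
  also have "\<dots> = (\<Sum>i<d s. \<Sum>j<d s. if j = i then if r = s then of_nat (d s) * \<pi> s z $$ (i, i) else 0 else 0)"
    unfolding N_def by (intro sum.cong refl) (simp add: isotypic_acts[OF r s, simplified])
  also have "\<dots> = (if r = s then isotypic s z else 0)"
    using isotypic_entries[OF s z] by (simp add: sum_distrib_left)
  finally show ?thesis .
qed

text \<open>The idempotents add up to the unit of convolution. This is where completeness of the system of
  representations is used: their sum acts as the identity on each \<open>\<pi> s\<close>, hence on every irreducible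
  representation.\<close>

lemma sum_isotypic:
  assumes z: "z \<in> carrier G"
  shows "(\<Sum>r=1..k. isotypic r z) = (if z = \<one> then of_nat (card (carrier G)) else 0)"
proof -
  define E where "E z = (\<Sum>r=1..k. isotypic r z)" for z
  have E: "group_algebra_op E (d s) (\<pi> s) = 1\<^sub>m (d s)" if s: "s \<in> {1..k}" for s
  proof (rule eq_matI)
    fix i j assume "i < dim_row (1\<^sub>m (d s) :: complex mat)" "j < dim_col (1\<^sub>m (d s) :: complex mat)"
    then have ij: "i < d s" "j < d s" by auto
    have "group_algebra_op E (d s) (\<pi> s) $$ (i, j)
        = (\<Sum>r=1..k. 1 / of_nat (card (carrier G)) * (\<Sum>x\<in>carrier G. isotypic r x * \<pi> s (inv x) $$ (i, j)))"
      using ij unfolding group_algebra_op_def E_def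
      by (simp add: sum_distrib_left sum_distrib_right) (rule sum.swap)
    also have "\<dots> = (\<Sum>r=1..k. if r = s then if i = j then 1 else 0 else 0)"
      by (rule sum.cong[OF refl], subst isotypic_acts[OF _ s ij]) auto
    also have "\<dots> = 1\<^sub>m (d s) $$ (i, j)" using s ij by simp
    finally show "group_algebra_op E (d s) (\<pi> s) $$ (i, j) = 1\<^sub>m (d s) $$ (i, j)" .
  qed (simp_all add: group_algebra_op_def)
  have "group_algebra_op E n \<rho> = 1\<^sub>m n" if \<rho>: "irreducible_unitary_rep G n \<rho>" for n \<rho>
  proof -
    obtain s where s: "s \<in> {1..k}" and "equivalent_reps G n \<rho> (d s) (\<pi> s)"
      using complete \<rho> unfolding complete_irreps_def by blast
    then obtain T B where T: "T \<in> carrier_mat (d s) n" and n: "n = d s"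
      and TB: "B * T = 1\<^sub>m (dim_row B)" "T * B = 1\<^sub>m (dim_row T)"
      and comm: "\<And>x. x \<in> carrier G \<Longrightarrow> T * \<rho> x = \<pi> s x * T"
      unfolding equivalent_reps_def invertible_mat_def inverts_mat_def by auto
    have "dim_row B = n" using arg_cong[OF TB(1), of dim_col] T by simp
    moreover have "dim_col B = d s" using arg_cong[OF TB(2), of dim_col] T by simp
    ultimately have B: "B \<in> carrier_mat n (d s)" and BT: "B * T = 1\<^sub>m n" using TB(1) by auto
    have P: "group_algebra_op E n \<rho> \<in> carrier_mat n n" by simp
    have "T * group_algebra_op E n \<rho> = T"
      using group_algebra_op_intertwines[OF irreducible_unitary_repD(1)[OF \<rho>] rep[OF s] T comm, of E]
        E[OF s] left_mult_one_mat[OF T] by simp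
    then have "(B * T) * group_algebra_op E n \<rho> = B * T"
      using assoc_mult_mat[OF B T P] by simp
    then show ?thesis unfolding BT left_mult_one_mat[OF P] .
  qed
  then have "group_algebra_op E n \<rho> = 1\<^sub>m n" if "unitary_rep G n \<rho>" for n \<rho>
    using group_algebra_op_one_if_irreducible that by blast
  from delta_if_group_algebra_op_one[OF this z] show ?thesis by (simp add: E_def)
qed

lemma convolution_sum_isotypic:
  assumes z: "z \<in> carrier G"
  shows "(\<Sum>r=1..k. convolution G (isotypic r) f z) = f z"
proof -
  have "(\<Sum>r=1..k. convolution G (isotypic r) f z) = convolution G (\<lambda>x. \<Sum>r=1..k. 1 * isotypic r x) f z"
    unfolding convolution_sum_left by simp
  also have "\<dots> = 1 / of_nat (card (carrier G)) *
      (\<Sum>y\<in>carrier G. if y = \<one> then of_nat (card (carrier G)) * f z else 0)"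
    unfolding convolution_def using z sum_isotypic
    by (intro arg_cong[where f = "\<lambda>t. _ * t"] sum.cong) auto
  also have "\<dots> = f z" using finite_carrier z by (auto simp: card_eq_0_iff)
  finally show ?thesis .
qed

lemma isotypic_orthogonal:
  assumes r: "r \<in> {1..k}" and s: "s \<in> {1..k}" and "r \<noteq> s"
  shows "L2_inner G (convolution G (isotypic r) f) (convolution G (isotypic s) f) = 0"
proof -
  have "L2_inner G (convolution G (isotypic r) f) (convolution G (isotypic s) f)
      = L2_inner G f (convolution G (isotypic r) (convolution G (isotypic s) f))"
    by (rule L2_inner_convolution_left) (rule isotypic_inv[OF r])
  also have "\<dots> = L2_inner G f (convolution G (convolution G (isotypic r) (isotypic s)) f)"
    by (rule L2_inner_cong) (simp_all add: convolution_assoc)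
  also have "\<dots> = L2_inner G f (convolution G (\<lambda>_. 0) f)"
    by (rule L2_inner_cong[OF refl], rule convolution_cong)
      (use isotypic_convolution[OF r s] assms(3) in auto)
  also have "\<dots> = 0" by (simp add: L2_inner_def convolution_def)
  finally show ?thesis .
qed

text \<open>Convolution by a class function multiplies the isotypic component of index \<open>r\<close> by \<open>c r\<close>, and these
  components are pairwise orthogonal.\<close>

lemma norm_central_convolution:
  "(L2_norm G (convolution G (\<lambda>x. \<Sum>r=1..k. c r * isotypic r x) f))\<^sup>2
    = (\<Sum>r=1..k. (cmod (c r))\<^sup>2 * (L2_norm G (convolution G (isotypic r) f))\<^sup>2)"
proof -
  have "complex_of_real ((L2_norm G (convolution G (\<lambda>x. \<Sum>r=1..k. c r * isotypic r x) f))\<^sup>2)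
      = (\<Sum>r=1..k. \<Sum>s=1..k. c r * cnj (c s) *
          L2_inner G (convolution G (isotypic r) f) (convolution G (isotypic s) f))"
    unfolding L2_inner_self[symmetric] L2_inner_sum_sum[symmetric]
    by (rule L2_inner_cong) (simp_all add: convolution_sum_left)
  also have "\<dots> = (\<Sum>r=1..k. \<Sum>s=1..k. if s = r then
      complex_of_real ((cmod (c r))\<^sup>2 * (L2_norm G (convolution G (isotypic r) f))\<^sup>2) else 0)"
    by (intro sum.cong refl)
      (auto simp: isotypic_orthogonal L2_inner_self complex_norm_square simp del: of_real_power)
  also have "\<dots> = complex_of_real (\<Sum>r=1..k. (cmod (c r))\<^sup>2 * (L2_norm G (convolution G (isotypic r) f))\<^sup>2)"
    by simp
  finally show ?thesis by (simp only: of_real_eq_iff)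
qed

lemma plancherel: "(L2_norm G f)\<^sup>2 = (\<Sum>r=1..k. (L2_norm G (convolution G (isotypic r) f))\<^sup>2)"
proof -
  have "L2_norm G f = L2_norm G (convolution G (\<lambda>x. \<Sum>r=1..k. 1 * isotypic r x) f)"
    by (rule L2_norm_cong) (subst convolution_sum_left, simp only: mult_1 convolution_sum_isotypic)
  then show ?thesis by (simp only: norm_central_convolution) simp
qed

lemma k_pos: "k \<ge> 1"
proof (rule ccontr)
  assume "\<not> k \<ge> 1"
  then show False using sum_isotypic[OF one_closed] card_carrier_pos by simp
qed

lemma wavelet_norm:
  "(L2_norm G (convolution G (wavelet k d \<pi> \<gamma> j) f))\<^sup>2
    = (\<Sum>r=1..k. (cmod (\<gamma> j r))\<^sup>2 * (L2_norm G (convolution G (isotypic r) f))\<^sup>2)"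
proof -
  have "wavelet k d \<pi> \<gamma> j = (\<lambda>x. \<Sum>r=1..k. \<gamma> j r * isotypic r x)"
    by (auto simp: wavelet_def isotypic_def mult_ac)
  then show ?thesis by (simp only: norm_central_convolution)
qed

lemma wavelet_energy:
  assumes "admissible_kernel J k \<gamma>"
  shows "(L2_norm G (convolution G (wavelet k d \<pi> \<gamma> 0) f))\<^sup>2
     + (\<Sum>j=1..J. (L2_norm G (convolution G (wavelet k d \<pi> \<gamma> j) f))\<^sup>2) = (L2_norm G f)\<^sup>2"
proof -
  define q where "q r = (L2_norm G (convolution G (isotypic r) f))\<^sup>2" for r
  have "(\<Sum>j=1..J. (L2_norm G (convolution G (wavelet k d \<pi> \<gamma> j) f))\<^sup>2)
      = (\<Sum>r=1..k. (\<Sum>j=1..J. (cmod (\<gamma> j r))\<^sup>2) * q r)"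
    unfolding wavelet_norm q_def[symmetric] sum_distrib_right by (rule sum.swap)
  also have "\<dots> = (\<Sum>r=1..k. (1 - (cmod (\<gamma> 0 r))\<^sup>2) * q r)"
    using assms unfolding admissible_kernel_def by (intro sum.cong) auto
  finally show ?thesis
    unfolding wavelet_norm plancherel[of f] q_def[symmetric]
    by (simp add: sum.distrib[symmetric] algebra_simps)
qed

lemma low_pass_energy_ge:
  "(L2_norm G (convolution G (wavelet k d \<pi> \<gamma> 0) f))\<^sup>2 \<ge> kernel_beta k \<gamma> * (L2_norm G f)\<^sup>2"
proof -
  have "kernel_beta k \<gamma> \<le> (cmod (\<gamma> 0 r))\<^sup>2" if "r \<in> {1..k}" for r
    unfolding kernel_beta_def using that by (intro Min_le) auto
  then show ?thesis
    unfolding wavelet_norm plancherel[of f] sum_distrib_left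
    by (intro sum_mono mult_right_mono) auto
qed

lemma kernel_beta_le_1:
  assumes "admissible_kernel J k \<gamma>"
  shows "kernel_beta k \<gamma> \<le> 1"
proof -
  have 1: "1 \<in> {1..k}" using k_pos by simp
  have "kernel_beta k \<gamma> \<le> (cmod (\<gamma> 0 1))\<^sup>2"
    unfolding kernel_beta_def using 1 by (intro Min_le) auto
  also have "\<dots> = 1 - (\<Sum>j=1..J. (cmod (\<gamma> j 1))\<^sup>2)" using assms 1 unfolding admissible_kernel_def by simp
  also have "\<dots> \<le> 1" by (simp add: sum_nonneg)
  finally show ?thesis .
qed

end

section \<open>Energy along scattering paths\<close>

text \<open>The set \<open>\<Lambda>\<^sub>J\<^sup>m\<close> of paths of length \<open>m\<close>.\<close>

definition paths_of_length :: "nat \<Rightarrow> nat \<Rightarrow> nat list set" where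
  "paths_of_length J m = {p. length p = m \<and> set p \<subseteq> {1..J}}"

lemma finite_paths_of_length: "finite (paths_of_length J m)"
  using finite_lists_length_eq[of "{1..J}" m] by (simp add: paths_of_length_def conj_commute)

lemma paths_of_length_0: "paths_of_length J 0 = {[]}"
  by (auto simp: paths_of_length_def)

lemma sum_paths_Suc:
  "(\<Sum>p\<in>paths_of_length J (Suc m). h p) = (\<Sum>j=1..J. \<Sum>p\<in>paths_of_length J m. h (j # p))"
proof -
  have "paths_of_length J (Suc m) = (\<lambda>(j, p). j # p) ` ({1..J} \<times> paths_of_length J m)"
    by (auto simp: paths_of_length_def length_Suc_conv image_iff)
  moreover have "inj_on (\<lambda>(j, p). j # p) ({1..J} \<times> paths_of_length J m)"
    by (auto simp: inj_on_def)
  ultimately show ?thesis by (simp add: sum.reindex sum.cartesian_product case_prod_unfold)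
qed

context finite_group
begin

text \<open>Energy balance: the energy of \<open>f\<close> is the energy scattered along paths of length less than \<open>m\<close> plus
  the energy that is still propagated along paths of length \<open>m\<close>. Since the first entry of a path is
  applied first, the induction step applies the hypothesis to \<open>|\<psi>\<^sub>j * f|\<close>, which has the norm of \<open>\<psi>\<^sub>j * f\<close>.\<close>

lemma scattering_energy:
  assumes energy: "\<And>f. (L2_norm G (convolution G (\<psi> 0) f))\<^sup>2
     + (\<Sum>j=1..J. (L2_norm G (convolution G (\<psi> j) f))\<^sup>2) = (L2_norm G f)\<^sup>2"
  shows "(\<Sum>i<m. \<Sum>p\<in>paths_of_length J i. (L2_norm G (scattering_S G \<psi> p f))\<^sup>2)
     + (\<Sum>p\<in>paths_of_length J m. (L2_norm G (scattering_U G \<psi> p f))\<^sup>2) = (L2_norm G f)\<^sup>2"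
proof (induction m arbitrary: f)
  case 0
  show ?case by (simp add: paths_of_length_0)
next
  case (Suc m)
  define u where "u j = (\<lambda>x. complex_of_real (cmod (convolution G (\<psi> j) f x)))" for j
  have S: "scattering_S G \<psi> (j # p) f = scattering_S G \<psi> p (u j)" for j p
    by (simp add: scattering_S_def u_def)
  have U: "scattering_U G \<psi> (j # p) f = scattering_U G \<psi> p (u j)" for j p
    by (simp add: u_def)
  have "(\<Sum>i<Suc m. \<Sum>p\<in>paths_of_length J i. (L2_norm G (scattering_S G \<psi> p f))\<^sup>2)
     + (\<Sum>p\<in>paths_of_length J (Suc m). (L2_norm G (scattering_U G \<psi> p f))\<^sup>2)
    = (L2_norm G (convolution G (\<psi> 0) f))\<^sup>2
     + (\<Sum>j=1..J. (\<Sum>i<m. \<Sum>p\<in>paths_of_length J i. (L2_norm G (scattering_S G \<psi> p (u j)))\<^sup>2)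
       + (\<Sum>p\<in>paths_of_length J m. (L2_norm G (scattering_U G \<psi> p (u j)))\<^sup>2))"
    unfolding sum.lessThan_Suc_shift sum_paths_Suc S U paths_of_length_0 sum.distrib
    by (simp add: scattering_S_def sum.swap[of _ "{..<m}"])
  also have "\<dots> = (L2_norm G (convolution G (\<psi> 0) f))\<^sup>2 + (\<Sum>j=1..J. (L2_norm G (u j))\<^sup>2)"
    unfolding Suc.IH ..
  also have "\<dots> = (L2_norm G f)\<^sup>2"
    unfolding u_def L2_norm_cmod by (rule energy)
  finally show ?case .
qed

lemma propagated_energy_decay:
  assumes decay: "\<And>f. (\<Sum>j=1..J. (L2_norm G (convolution G (\<psi> j) f))\<^sup>2) \<le> q * (L2_norm G f)\<^sup>2" and q: "q \<ge> 0"
  shows "(\<Sum>p\<in>paths_of_length J m. (L2_norm G (scattering_U G \<psi> p f))\<^sup>2) \<le> q ^ m * (L2_norm G f)\<^sup>2"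
proof (induction m arbitrary: f)
  case 0
  show ?case by (simp add: paths_of_length_0)
next
  case (Suc m)
  define u where "u j = (\<lambda>x. complex_of_real (cmod (convolution G (\<psi> j) f x)))" for j
  have "(\<Sum>p\<in>paths_of_length J (Suc m). (L2_norm G (scattering_U G \<psi> p f))\<^sup>2)
      = (\<Sum>j=1..J. \<Sum>p\<in>paths_of_length J m. (L2_norm G (scattering_U G \<psi> p (u j)))\<^sup>2)"
    unfolding sum_paths_Suc by (simp add: u_def)
  also have "\<dots> \<le> (\<Sum>j=1..J. q ^ m * (L2_norm G (u j))\<^sup>2)" by (intro sum_mono Suc.IH)
  also have "\<dots> = q ^ m * (\<Sum>j=1..J. (L2_norm G (convolution G (\<psi> j) f))\<^sup>2)"
    unfolding u_def L2_norm_cmod sum_distrib_left ..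
  also have "\<dots> \<le> q ^ m * (q * (L2_norm G f)\<^sup>2)" using decay q by (intro mult_left_mono) auto
  finally show ?case by (simp add: mult_ac)
qed

end

lemma scattering_paths_eq: "scattering_paths J = (\<Union>m. paths_of_length J m)"
  by (simp add: scattering_paths_def paths_of_length_def)

text \<open>A nonnegative family on the paths may be summed by path length.\<close>

lemma has_sum_scattering_paths:
  fixes h :: "nat list \<Rightarrow> real"
  assumes nonneg: "\<And>p. h p \<ge> 0"
    and sums: "(\<lambda>i. \<Sum>p\<in>paths_of_length J i. h p) sums s"
  shows "(h has_sum s) (scattering_paths J)"
proof -
  define b where "b i = (\<Sum>p\<in>paths_of_length J i. h p)" for i
  have b: "b i \<ge> 0" for i unfolding b_def by (simp add: sum_nonneg nonneg)
  have bs: "b sums s" using sums unfolding b_def .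
  define A where "A M = (\<Union>i<M. paths_of_length J i)" for M
  have A: "finite (A M)" "A M \<subseteq> scattering_paths J" for M
    by (auto simp: A_def finite_paths_of_length scattering_paths_eq)
  have sumA: "sum h (A M) = (\<Sum>i<M. b i)" for M
    unfolding A_def b_def
    by (rule sum.UNION_disjoint) (auto simp: finite_paths_of_length, auto simp: paths_of_length_def)
  have le: "sum h F \<le> s" if F: "finite F" "F \<subseteq> scattering_paths J" for F
  proof -
    have "F \<subseteq> A (Suc (Max (length ` F)))"
    proof
      fix p assume p: "p \<in> F"
      have "length p \<le> Max (length ` F)" using p F(1) by simp
      moreover have "p \<in> paths_of_length J (length p)"
        using p F(2) by (auto simp: scattering_paths_def paths_of_length_def)
      ultimately show "p \<in> A (Suc (Max (length ` F)))" unfolding A_def by (auto simp: less_Suc_eq_le)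
    qed
    then have "sum h F \<le> sum h (A (Suc (Max (length ` F))))"
      by (intro sum_mono2) (auto simp: A nonneg)
    also have "\<dots> \<le> s" unfolding sumA
      using sum_le_suminf[OF sums_summable[OF bs], of "{..<Suc (Max (length ` F))}"] b sums_unique[OF bs] by simp
    finally show ?thesis .
  qed
  have summable: "h summable_on scattering_paths J"
    by (rule nonneg_bdd_above_summable_on) (use nonneg le in \<open>auto intro!: bdd_aboveI[of _ s]\<close>)
  have "infsum h (scattering_paths J) = s"
  proof (rule antisym)
    show "infsum h (scattering_paths J) \<le> s" by (rule infsum_le_finite_sums[OF summable le])
    have "(\<Sum>i<M. b i) \<le> infsum h (scattering_paths J)" for M
      unfolding sumA[symmetric] by (rule finite_sum_le_infsum[OF summable A]) (rule nonneg)
    then show "s \<le> infsum h (scattering_paths J)"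
      using bs unfolding sums_def by (intro LIMSEQ_le_const2) auto
  qed
  then show ?thesis using summable has_sum_infsum by blast
qed

theorem theorem4p6:
  fixes G :: "('a, 'b) monoid_scheme"
    and k J :: nat
    and d :: "nat \<Rightarrow> nat"
    and \<pi> :: "nat \<Rightarrow> 'a \<Rightarrow> complex mat"
    and \<gamma> :: "nat \<Rightarrow> nat \<Rightarrow> complex"
    and f :: "'a \<Rightarrow> complex"
  assumes "group G" and "finite (carrier G)"
    and "complete_irreps G k d \<pi>"
    and "J \<ge> 1"
    and "admissible_kernel J k \<gamma>"
  shows "path_family_finite_norm G J (\<lambda>p. scattering_S G (wavelet k d \<pi> \<gamma>) p f) \<and>
         path_family_norm G J (\<lambda>p. scattering_S G (wavelet k d \<pi> \<gamma>) p f) = L2_norm G f"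
proof -
  interpret group G by fact
  interpret finite_group_irreps G k d \<pi> by unfold_locales (use assms in auto)
  define \<psi> where "\<psi> = wavelet k d \<pi> \<gamma>"
  define q where "q = 1 - kernel_beta k \<gamma>"
  define a where "a m = (\<Sum>p\<in>paths_of_length J m. (L2_norm G (scattering_U G \<psi> p f))\<^sup>2)" for m
  define b where "b m = (\<Sum>p\<in>paths_of_length J m. (L2_norm G (scattering_S G \<psi> p f))\<^sup>2)" for m
  have q: "0 \<le> q" "q < 1"
    using kernel_beta_le_1[OF assms(5)] assms(5) unfolding q_def admissible_kernel_def by auto
  note energy = wavelet_energy[OF assms(5), folded \<psi>_def]
  have "(\<Sum>j=1..J. (L2_norm G (convolution G (\<psi> j) g))\<^sup>2) \<le> q * (L2_norm G g)\<^sup>2" for g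
    using energy[of g] low_pass_energy_ge[of \<gamma> g] unfolding \<psi>_def q_def by (simp add: algebra_simps)
  then have bound: "a m \<le> q ^ m * (L2_norm G f)\<^sup>2" for m
    unfolding a_def using q by (intro propagated_energy_decay)
  have lim: "(\<lambda>m. q ^ m * (L2_norm G f)\<^sup>2) \<longlonglongrightarrow> 0"
    using q by (intro tendsto_mult_left_zero LIMSEQ_realpow_zero) auto
  have "a \<longlonglongrightarrow> 0"
    by (rule tendsto_sandwich[OF _ _ tendsto_const lim])
      (use bound in \<open>auto simp: a_def sum_nonneg\<close>)
  then have "(\<lambda>m. (L2_norm G f)\<^sup>2 - a m) \<longlonglongrightarrow> (L2_norm G f)\<^sup>2 - 0"
    by (intro tendsto_diff tendsto_const)
  moreover have "(\<Sum>i<m. b i) = (L2_norm G f)\<^sup>2 - a m" for m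
    using scattering_energy[of \<psi> J, OF energy, of f m] unfolding a_def b_def by simp
  ultimately have "b sums (L2_norm G f)\<^sup>2" unfolding sums_def by simp
  then have "((\<lambda>p. (L2_norm G (scattering_S G \<psi> p f))\<^sup>2) has_sum (L2_norm G f)\<^sup>2) (scattering_paths J)"
    unfolding b_def by (intro has_sum_scattering_paths) auto
  then show ?thesis
    unfolding path_family_finite_norm_def path_family_norm_def \<psi>_def[symmetric]
    using infsumI has_sum_imp_summable L2_norm_nonneg by (auto simp: infsumI)
qed

end
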